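(* Let $K\subset\mathbb{C}$ be a convex polygon (bounded, with nonempty interior) none of whose interior angles at its vertices is acute, i.e. every interior angle is at least $\pi/2$, and let $1\le q<\infty$. Then there exists a constant $C_K>0$, depending only on $K$, such that $M_{n,q}(K)>C_K\, n$ for all $n\in\mathbb{N}$.
   Context: For $0<q<\infty$, $\|f\|_{L^q(\partial K)}=\left(\int_{\partial K}|f(z)|^q|dz|\right)^{1/q}$ (integration with respect to arc length on the boundary). $\mathcal{P}_n(K)$ denotes the set of complex polynomials of degree exactly $n$ all of whose $n$ zeros lie in $K$. The oscillation factor is $M_{n,q}(K):=\inf_{p\in\mathcal{P}_n(K)} \|p'\|_{L^q(\partial K)}/\|p\|_{L^q(\partial K)}$. *)

theory Defs
  imports "HOL-Analysis.Analysis" "HOL-Computational_Algebra.Polynomial"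
begin

definition convex_polygon :: "complex set \<Rightarrow> bool" where
  "convex_polygon K \<longleftrightarrow> (\<exists>S. finite S \<and> K = convex hull S) \<and> interior K \<noteq> {}"

definition vec_angle :: "complex \<Rightarrow> complex \<Rightarrow> real" where
  "vec_angle a b = arccos (Re (a * cnj b) / (cmod a * cmod b))"

text \<open>Interior angle of the convex set K at the vertex v: the opening of the cone
  spanned by K at v (for a convex polygon, the angle between the two edges at v).\<close>
definition interior_angle :: "complex set \<Rightarrow> complex \<Rightarrow> real" where
  "interior_angle K v =
     Sup {vec_angle (w1 - v) (w2 - v) | w1 w2. w1 \<in> K \<and> w2 \<in> K \<and> w1 \<noteq> v \<and> w2 \<noteq> v}"

text \<open>Edges of a convex polygon, as ordered pairs of (adjacent) vertices; each edge
  appears twice, once in each orientation.\<close>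
definition polygon_edges :: "complex set \<Rightarrow> (complex \<times> complex) set" where
  "polygon_edges K = {(v, w). v extreme_point_of K \<and> w extreme_point_of K \<and> v \<noteq> w
                         \<and> closed_segment v w \<subseteq> frontier K}"

definition boundary_integral :: "complex set \<Rightarrow> (complex \<Rightarrow> real) \<Rightarrow> real" where
  "boundary_integral K g =
     (\<Sum>(v, w) \<in> polygon_edges K.
        integral {0..1} (\<lambda>t::real. g (v + complex_of_real t * (w - v))) * cmod (w - v)) / 2"

definition Lq_boundary_norm :: "complex set \<Rightarrow> real \<Rightarrow> (complex \<Rightarrow> complex) \<Rightarrow> real" where
  "Lq_boundary_norm K q f = (boundary_integral K (\<lambda>z. cmod (f z) powr q)) powr (1 / q)"

definition polys_in :: "complex set \<Rightarrow> nat \<Rightarrow> complex poly set" where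
  "polys_in K n = {p. degree p = n \<and> (\<forall>z. poly p z = 0 \<longrightarrow> z \<in> K)}"

definition oscillation_factor :: "nat \<Rightarrow> real \<Rightarrow> complex set \<Rightarrow> real" where
  "oscillation_factor n q K =
     Inf ((\<lambda>p. Lq_boundary_norm K q (poly (pderiv p)) / Lq_boundary_norm K q (poly p))
            ` polys_in K n)"

end

theory Submission
  imports Defs "HOL-Computational_Algebra.Fundamental_Theorem_Algebra"
begin

text \<open>Let \<open>z\<^sub>1, \<dots>, z\<^sub>n\<close> be the zeros of \<open>p\<close>. If a fixed proportion of them stays away from an edge \<open>e\<close>
  with unit normal \<open>\<nu>\<close>, then on \<open>e\<close> the sum \<open>p' / p = (\<Sum>i. 1 / (z - z\<^sub>i))\<close> has a component of order \<open>n\<close>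
  in the direction of \<open>\<nu>\<close>, so \<open>|p'| \<ge> c n |p|\<close> pointwise on \<open>e\<close>.

  If instead nearly all zeros are close to \<open>e\<close>, then the two non-acute angles at its ends put a rectangle
  with base \<open>e\<close> into \<open>K\<close>. Hence every \<open>x \<in> e\<close> has a boundary piece \<open>T\<close> across \<open>K\<close>, on an edge \<open>f\<close>
  disjoint from \<open>e\<close>, that is farther than \<open>x\<close> by a fixed factor from all zeros close to \<open>e\<close>. Comparing mean
  logarithms over \<open>T\<close> factor by factor, the few remaining zeros are harmless, and \<open>|p(x)|\<^sup>q\<close> is at most
  the mean of \<open>|p|\<^sup>q\<close> over \<open>T\<close>. As the zeros close to \<open>e\<close> stay away from \<open>f\<close>, the first case applies to
  \<open>f\<close>, and so the edges of the first kind carry a fixed proportion of the integral of \<open>|p|\<^sup>q\<close>.\<close>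

subsection \<open>Edges of a convex polygon\<close>

text \<open>Lagrange's identity makes the determinant \<open>D\<close> of \<open>t\<close> and
  \<open>n\<close> nonzero; Cramer's rule then recovers \<open>d\<close> from its inner products
  with \<open>t\<close> and \<open>n\<close>.\<close>

lemma complex_eq_0_if_orthogonal_pair:
  fixes d t n :: complex
  assumes "n \<bullet> t = 0" "n \<noteq> 0" "t \<noteq> 0" "d \<bullet> t = 0" "d \<bullet> n = 0"
  shows "d = 0"
proof -
  define D where "D = Re t * Im n - Im t * Re n"
  have "D\<^sup>2 + (n \<bullet> t)\<^sup>2 = (t \<bullet> t) * (n \<bullet> n)"
    unfolding D_def inner_complex_def by (simp add: power2_eq_square algebra_simps)
  hence "D \<noteq> 0" using assms by auto
  moreover have "Re d * D = (d \<bullet> t) * Im n - (d \<bullet> n) * Im t" "Im d * D = (d \<bullet> n) * Re t - (d \<bullet> t) * Re n"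
    unfolding D_def inner_complex_def by (simp_all add: algebra_simps)
  ultimately show ?thesis using assms by (simp add: complex_eq_iff)
qed

lemma orthogonal_decomposition:
  fixes t n u :: complex
  assumes "n \<bullet> t = 0" "norm n = 1" "t \<noteq> 0"
  shows "u = ((u \<bullet> t) / (t \<bullet> t)) *\<^sub>R t + (u \<bullet> n) *\<^sub>R n"
proof -
  have nn: "n \<bullet> n = 1" "n \<noteq> 0" using assms by (auto simp: norm_eq_1)
  have "u - (((u \<bullet> t) / (t \<bullet> t)) *\<^sub>R t + (u \<bullet> n) *\<^sub>R n) = 0"
    using assms nn
    by (intro complex_eq_0_if_orthogonal_pair[of n t])
       (auto simp: inner_diff_left inner_add_left inner_commute[of t n])
  thus ?thesis by simp
qed

lemma frontier_support:
  fixes K :: "complex set"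
  assumes "convex K" "closed K" "interior K \<noteq> {}" "z \<in> frontier K"
  obtains a where "a \<noteq> 0" "\<And>y. y \<in> K \<Longrightarrow> a \<bullet> z \<le> a \<bullet> y"
proof -
  have "rel_interior K = interior K" using assms(3) by (rule rel_interior_nonempty_interior)
  moreover have "z \<in> K" "z \<notin> interior K" using assms by (auto simp: frontier_def)
  ultimately show ?thesis using supporting_hyperplane_rel_boundary[of K z] assms that by metis
qed

text \<open>From an interior point a short step against \<open>a\<close> would stay in
  \<open>K\<close> and push the linear form below its lower bound \<open>b\<close>.\<close>

lemma supporting_face_subset_frontier:
  fixes K :: "complex set"
  assumes "a \<noteq> 0" "\<And>y. y \<in> K \<Longrightarrow> b \<le> a \<bullet> y" "x \<in> K" "a \<bullet> x = b"
  shows "x \<in> frontier K"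
proof -
  have "x \<notin> interior K"
  proof
    assume "x \<in> interior K"
    then obtain e where e: "e > 0" "ball x e \<subseteq> K" by (auto simp: mem_interior)
    define y where "y = x - (e / 2 / norm a) *\<^sub>R a"
    have "dist x y < e" using e assms by (simp add: y_def dist_norm)
    hence "b \<le> a \<bullet> y" using e assms by (auto simp: subset_eq)
    moreover have "a \<bullet> y = b - (e / 2 / norm a) * (a \<bullet> a)" using assms by (simp add: y_def inner_diff_right)
    moreover have "(e / 2 / norm a) * (a \<bullet> a) > 0" using e assms by simp
    ultimately show False by simp
  qed
  thus ?thesis using assms closure_subset[of K] by (auto simp: frontier_def)
qed

lemma convex_polygonD:
  assumes "convex_polygon K"
  shows "compact K" "convex K" "closed K" "interior K \<noteq> {}" "finite {v. v extreme_point_of K}" "finite (polygon_edges K)"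
proof -
  obtain S where S: "finite S" "K = convex hull S" using assms by (auto simp: convex_polygon_def)
  show "compact K" "convex K" "closed K" using S by (auto simp: finite_imp_compact_convex_hull compact_imp_closed)
  show "interior K \<noteq> {}" using assms by (auto simp: convex_polygon_def)
  show fin: "finite {v. v extreme_point_of K}"
    using S by (metis extreme_points_of_convex_hull finite_subset)
  have "polygon_edges K \<subseteq> {v. v extreme_point_of K} \<times> {v. v extreme_point_of K}" by (auto simp: polygon_edges_def)
  thus "finite (polygon_edges K)" using fin by (meson finite_SigmaI finite_subset)
qed

lemma polygon_edges_sym: "(v, w) \<in> polygon_edges K \<Longrightarrow> (w, v) \<in> polygon_edges K"
  by (auto simp: polygon_edges_def closed_segment_commute)

lemma polygon_edgesD:
  assumes "(v, w) \<in> polygon_edges K" "closed K"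
  shows "v \<in> K" "w \<in> K" "v \<noteq> w" "closed_segment v w \<subseteq> K" "closed_segment v w \<subseteq> frontier K"
  using assms frontier_subset_closed[of K] by (auto simp: polygon_edges_def extreme_point_of_def)

text \<open>The inward unit normal of an edge. By the last conjunct the supporting line meets
  \<open>K\<close> only in the edge, so that heights over the edge are positive on the rest of
  \<open>K\<close>.\<close>

definition edge_normal :: "complex set \<Rightarrow> complex \<Rightarrow> complex \<Rightarrow> complex \<Rightarrow> bool" where
  "edge_normal K v w \<nu> \<longleftrightarrow> norm \<nu> = 1 \<and> \<nu> \<bullet> (w - v) = 0 \<and> (\<forall>z\<in>K. \<nu> \<bullet> (z - v) \<ge> 0)
     \<and> (\<forall>z\<in>K. \<nu> \<bullet> (z - v) = 0 \<longrightarrow> z \<in> closed_segment v w)"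

text \<open>The supporting line at the midpoint contains the whole edge, since the minimal value
  there is the average of the values at \<open>v\<close> and \<open>w\<close>. A point of
  \<open>K\<close> on this line beyond \<open>v\<close> or \<open>w\<close> would place that vertex
  inside a segment of \<open>K\<close>, against extremality.\<close>

lemma edge_normal_exists:
  assumes "convex_polygon K" "(v, w) \<in> polygon_edges K"
  obtains \<nu> where "edge_normal K v w \<nu>"
proof -
  note K = convex_polygonD[OF assms(1)]
  note E = polygon_edgesD[OF assms(2) K(3)]
  define m where "m = midpoint v w"
  have "m \<in> frontier K" using E(5) by (auto simp: m_def)
  then obtain a where a: "a \<noteq> 0" "\<And>y. y \<in> K \<Longrightarrow> a \<bullet> m \<le> a \<bullet> y"
    using frontier_support K by metis
  have m2: "2 * (a \<bullet> m) = a \<bullet> v + a \<bullet> w"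
    by (simp add: m_def midpoint_def inner_add_right)
  have av: "a \<bullet> v = a \<bullet> m" "a \<bullet> w = a \<bullet> m" using a(2)[OF E(1)] a(2)[OF E(2)] m2 by auto
  define \<nu> where "\<nu> = a /\<^sub>R norm a"
  have perp: "\<nu> \<bullet> (w - v) = 0" using av by (simp add: \<nu>_def inner_diff_right)
  have n1: "norm \<nu> = 1" using a by (simp add: \<nu>_def)
  have "z \<in> closed_segment v w" if z: "z \<in> K" "\<nu> \<bullet> (z - v) = 0" for z
  proof -
    define s where "s = ((z - v) \<bullet> (w - v)) / ((w - v) \<bullet> (w - v))"
    have "z - v = s *\<^sub>R (w - v) + ((z - v) \<bullet> \<nu>) *\<^sub>R \<nu>"
      unfolding s_def using orthogonal_decomposition[OF perp n1] E(3) by simp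
    hence zs: "z = v + s *\<^sub>R (w - v)" using z by (simp add: inner_commute algebra_simps)
    have ext: "v extreme_point_of K" "w extreme_point_of K" using assms(2) by (auto simp: polygon_edges_def)
    have "s \<ge> 0"
    proof (rule ccontr)
      assume s: "\<not> s \<ge> 0"
      \<comment> \<open>The weight solving \<open>(1 - u) * s + u = 0\<close>, which exhibits
        \<open>v\<close> strictly between \<open>z\<close> and \<open>w\<close>.\<close>
      define u where "u = - s / (1 - s)"
      have "u > 0" "u < 1" using s by (auto simp: u_def field_simps)
      moreover have "v = (1 - u) *\<^sub>R z + u *\<^sub>R w"
      proof -
        have "(1 - u) *\<^sub>R z + u *\<^sub>R w - v = ((1 - u) * s + u) *\<^sub>R (w - v)"
          unfolding zs by (simp add: algebra_simps)
        also have "(1 - u) * s + u = 0" using s by (simp add: u_def field_simps)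
        finally show ?thesis by simp
      qed
      moreover have "z \<noteq> w"
      proof
        assume "z = w"
        moreover have "(1 - s) *\<^sub>R (w - v) = w - (v + s *\<^sub>R (w - v))" by (simp add: algebra_simps)
        ultimately have "(1 - s) *\<^sub>R (w - v) = 0" using zs by simp
        thus False using s E(3) by simp
      qed
      ultimately have "v \<in> open_segment z w" by (auto simp: in_segment)
      thus False using ext z E by (auto simp: extreme_point_of_def)
    qed
    moreover have "s \<le> 1"
    proof (rule ccontr)
      assume s: "\<not> s \<le> 1"
      define u where "u = 1 / s"
      have "u > 0" "u < 1" using s by (auto simp: u_def field_simps)
      moreover have "w = (1 - u) *\<^sub>R v + u *\<^sub>R z"
      proof -
        have "(1 - u) *\<^sub>R v + u *\<^sub>R z - w = (u * s - 1) *\<^sub>R (w - v)"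
          unfolding zs by (simp add: algebra_simps)
        also have "u * s - 1 = 0" using s by (simp add: u_def field_simps)
        finally show ?thesis by simp
      qed
      moreover have "v \<noteq> z" using s zs E(3) by auto
      ultimately have "w \<in> open_segment v z" by (auto simp: in_segment)
      thus False using ext z E by (auto simp: extreme_point_of_def)
    qed
    ultimately show ?thesis unfolding in_segment zs
      by (intro exI[of _ s]) (auto simp: algebra_simps)
  qed
  moreover have "\<nu> \<bullet> (z - v) \<ge> 0" if "z \<in> K" for z
    using a(2)[OF that] av by (simp add: \<nu>_def inner_diff_right mult_left_mono)
  ultimately have "edge_normal K v w \<nu>" using n1 perp unfolding edge_normal_def by blast
  thus ?thesis by (rule that)
qed

text \<open>A supporting line at \<open>z\<close> cuts out a face of \<open>K\<close> that is a
  segment, and the ends of a face are extreme in \<open>K\<close>. The segment is not a single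
  point, for then \<open>z\<close> itself would be extreme.\<close>

lemma nonextreme_frontier_point_in_edge:
  assumes "convex_polygon K" "z \<in> frontier K" "\<not> z extreme_point_of K"
  obtains a b where "(a, b) \<in> polygon_edges K" "z \<in> closed_segment a b"
proof -
  note K = convex_polygonD[OF assms(1)]
  have zK: "z \<in> K" using assms(2) K(3) frontier_subset_closed by blast
  obtain a where a: "a \<noteq> 0" "\<And>y. y \<in> K \<Longrightarrow> a \<bullet> z \<le> a \<bullet> y"
    using frontier_support K assms(2) by metis
  define F where "F = K \<inter> {x. a \<bullet> x = a \<bullet> z}"
  have face: "F face_of K" unfolding F_def using a K by (intro face_of_Int_supporting_hyperplane_ge) auto
  have "collinear {x. a \<bullet> x = a \<bullet> z}" using a(1) by (simp add: collinear_aff_dim)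
  hence "collinear F" unfolding F_def by (rule collinear_subset) auto
  moreover have "compact F" "convex F" "F \<noteq> {}" using K zK
    by (auto simp: F_def compact_Int_closed closed_hyperplane convex_Int convex_hyperplane)
  ultimately obtain b c where bc: "F = closed_segment b c" using compact_convex_collinear_segment by metis
  have "b extreme_point_of K" "c extreme_point_of K"
    using extreme_point_of_face[OF face] bc extreme_point_of_segment by blast+
  moreover have "b \<noteq> c"
  proof
    assume "b = c"
    moreover have "z \<in> F" using zK by (simp add: F_def)
    ultimately have "z = b" using bc by simp
    thus False using \<open>b extreme_point_of K\<close> assms(3) by simp
  qed
  moreover have "closed_segment b c \<subseteq> frontier K"
    using supporting_face_subset_frontier[OF a] bc F_def by blast
  ultimately show ?thesis using that[of b c] bc zK by (auto simp: polygon_edges_def F_def)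
qed

section \<open>Non-acute vertices and the rectangle over an edge\<close>

text \<open>Otherwise \<open>K\<close> lies in a cone at \<open>v\<close> around the direction of
  \<open>w\<close> that is uniformly narrower than a half-plane. As \<open>K\<close> also lies on
  one side of the line through \<open>v\<close> and \<open>w\<close>, the cosines of all angles at
  \<open>v\<close> are bounded below by some \<open>\<kappa> > 0\<close>, so the interior angle is
  acute.\<close>

lemma nonacute_vertex_direction:
  assumes "convex_polygon K" "interior_angle K v \<ge> pi / 2" "w \<in> K" "w \<noteq> v"
    and n: "\<nu> \<bullet> (w - v) = 0" "norm \<nu> = 1" "\<And>z. z \<in> K \<Longrightarrow> \<nu> \<bullet> (z - v) \<ge> 0"
  obtains (direction) s where "s \<in> K" "s \<noteq> v" "(s - v) \<bullet> (w - v) \<le> 0"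
proof (rule ccontr)
  assume "\<not> thesis"
  hence pos: "(s - v) \<bullet> (w - v) > 0" if "s \<in> K" "s \<noteq> v" for s using direction[of s] that by force
  obtain S where S: "finite S" "K = convex hull S" using assms by (auto simp: convex_polygon_def)
  define t where "t = w - v"
  have t0: "t \<noteq> 0" "t \<bullet> t > 0" using assms by (auto simp: t_def)
  \<comment> \<open>A minimum over finitely many generators, hence positive. A uniform bound is
    required because the interior angle is a supremum.\<close>
  define c where "c = Min ((\<lambda>s. ((s - v) \<bullet> t) / norm (s - v)) ` (S - {v}))"
  have ne: "S - {v} \<noteq> {}"
  proof
    assume "S - {v} = {}"
    hence "K \<subseteq> {v}" unfolding S(2) by (intro hull_minimal) auto
    thus False using assms by auto
  qed
  have "c \<in> (\<lambda>s. ((s - v) \<bullet> t) / norm (s - v)) ` (S - {v})"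
    unfolding c_def using S ne by (intro Min_in) auto
  hence c0: "c > 0" using pos hull_subset[of S convex] S(2) by (auto simp: t_def intro!: divide_pos_pos)
  \<comment> \<open>The inequality describes a convex cone with apex \<open>v\<close>, so it passes
    from the generators to their hull.\<close>
  have cone: "c * norm (y - v) \<le> (y - v) \<bullet> t" if "y \<in> K" for y
  proof -
    have "K \<subseteq> {y. c * norm (y - v) \<le> (y - v) \<bullet> t}" unfolding S(2)
    proof (intro hull_minimal)
      show "S \<subseteq> {y. c * norm (y - v) \<le> (y - v) \<bullet> t}"
      proof clarify
        fix s assume s: "s \<in> S"
        show "c * norm (s - v) \<le> (s - v) \<bullet> t"
        proof (cases "s = v")
          case False
          have "c \<le> ((s - v) \<bullet> t) / norm (s - v)" unfolding c_def using S s False by (intro Min_le) auto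
          thus ?thesis using False by (simp add: field_simps)
        qed simp
      qed
      show "convex {y. c * norm (y - v) \<le> (y - v) \<bullet> t}"
      proof (rule convexI)
        fix x y :: complex and u r :: real
        assume x: "x \<in> {y. c * norm (y - v) \<le> (y - v) \<bullet> t}" and y: "y \<in> {y. c * norm (y - v) \<le> (y - v) \<bullet> t}"
          and ur: "0 \<le> u" "0 \<le> r" "u + r = 1"
        have e: "u *\<^sub>R x + r *\<^sub>R y - v = u *\<^sub>R (x - v) + r *\<^sub>R (y - v)"
        proof -
          have "v = (u + r) *\<^sub>R v" using ur by simp
          thus ?thesis by (simp add: algebra_simps)
        qed
        have "c * norm (u *\<^sub>R (x - v) + r *\<^sub>R (y - v)) \<le> c * (u * norm (x - v) + r * norm (y - v))"
          using c0 ur norm_triangle_ineq[of "u *\<^sub>R (x - v)" "r *\<^sub>R (y - v)"] by (intro mult_left_mono) auto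
        also have "\<dots> = u * (c * norm (x - v)) + r * (c * norm (y - v))" by (simp add: algebra_simps)
        also have "\<dots> \<le> u * ((x - v) \<bullet> t) + r * ((y - v) \<bullet> t)"
          using x y ur by (intro add_mono mult_left_mono) auto
        finally show "u *\<^sub>R x + r *\<^sub>R y \<in> {y. c * norm (y - v) \<le> (y - v) \<bullet> t}"
          by (simp add: e inner_add_left)
      qed
    qed
    thus ?thesis using that by auto
  qed
  define \<kappa> where "\<kappa> = c * c / (t \<bullet> t)"
  have \<kappa>: "\<kappa> > 0" using c0 t0 by (simp add: \<kappa>_def)
  \<comment> \<open>In the decomposition along \<open>t\<close> and \<open>\<nu>\<close> the
    tangential parts account for \<open>\<kappa>\<close>; the product of the normal parts is
    nonnegative, both points being on the same side of the edge.\<close>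
  have cos: "\<kappa> \<le> Re ((y - v) * cnj (z - v)) / (cmod (y - v) * cmod (z - v))"
    if yz: "y \<in> K" "z \<in> K" "y \<noteq> v" "z \<noteq> v" for y z
  proof -
    have perp: "\<nu> \<bullet> t = 0" using n by (simp add: t_def)
    have "(y - v) \<bullet> (z - v) = ((((y - v) \<bullet> t) / (t \<bullet> t)) *\<^sub>R t + ((y - v) \<bullet> \<nu>) *\<^sub>R \<nu>) \<bullet> (z - v)"
      using orthogonal_decomposition[OF perp n(2) t0(1), of "y - v"] by simp
    also have "\<dots> = ((y - v) \<bullet> t) * ((z - v) \<bullet> t) / (t \<bullet> t) + (\<nu> \<bullet> (y - v)) * (\<nu> \<bullet> (z - v))"
      by (simp add: inner_add_left inner_commute[of "z - v" t] inner_commute[of "y - v" \<nu>])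
    also have "\<dots> \<ge> ((y - v) \<bullet> t) * ((z - v) \<bullet> t) / (t \<bullet> t)"
      using n(3) yz by simp
    also have "((y - v) \<bullet> t) * ((z - v) \<bullet> t) / (t \<bullet> t) \<ge> (c * norm (y - v)) * (c * norm (z - v)) / (t \<bullet> t)"
      using t0 c0 cone yz pos[OF yz(1,3)] by (intro divide_right_mono mult_mono) (auto simp: t_def)
    also have "(y - v) \<bullet> (z - v) = Re ((y - v) * cnj (z - v))" by (simp add: inner_complex_def algebra_simps)
    finally have "(c * norm (y - v)) * (c * norm (z - v)) / (t \<bullet> t) \<le> Re ((y - v) * cnj (z - v))" .
    thus ?thesis using yz t0 by (simp add: \<kappa>_def field_simps)
  qed
  \<comment> \<open>The cone inequality at \<open>w\<close> itself keeps \<open>\<kappa>\<close> in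
    the domain where \<open>arccos\<close> decreases.\<close>
  have \<kappa>1: "\<kappa> \<le> 1"
  proof -
    have "(c * norm t)\<^sup>2 \<le> (t \<bullet> t)\<^sup>2" using cone[OF assms(3)] c0 by (intro power_mono) (auto simp: t_def)
    hence "(c * c) * (t \<bullet> t) \<le> (t \<bullet> t) * (t \<bullet> t)"
      unfolding power_mult_distrib power2_norm_eq_inner by (simp add: power2_eq_square)
    thus ?thesis using t0 by (simp add: \<kappa>_def field_simps)
  qed
  have "interior_angle K v \<le> arccos \<kappa>" unfolding interior_angle_def
  proof (intro cSup_least)
    show "{vec_angle (w1 - v) (w2 - v) | w1 w2. w1 \<in> K \<and> w2 \<in> K \<and> w1 \<noteq> v \<and> w2 \<noteq> v} \<noteq> {}"
      using assms by auto
    fix a assume "a \<in> {vec_angle (w1 - v) (w2 - v) | w1 w2. w1 \<in> K \<and> w2 \<in> K \<and> w1 \<noteq> v \<and> w2 \<noteq> v}"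
    then obtain y z where yz: "a = vec_angle (y - v) (z - v)" "y \<in> K" "z \<in> K" "y \<noteq> v" "z \<noteq> v" by auto
    have "Re ((y - v) * cnj (z - v)) / (cmod (y - v) * cmod (z - v)) \<le> 1"
      using complex_Re_le_cmod[of "(y - v) * cnj (z - v)"] yz by (simp add: norm_mult del: complex_cnj_diff)
    thus "a \<le> arccos \<kappa>" unfolding yz(1) vec_angle_def
      using cos[OF yz(2-5)] \<kappa> by (intro arccos_le_arccos) auto
  qed
  also have "arccos \<kappa> < arccos 0" using \<kappa> \<kappa>1 by (intro arccos_less_arccos) auto
  finally show False using assms by simp
qed

lemma edge_normalD:
  assumes "edge_normal K v w \<nu>"
  shows "norm \<nu> = 1" "\<nu> \<bullet> (w - v) = 0" "\<nu> \<bullet> w = \<nu> \<bullet> v" "\<And>z. z \<in> K \<Longrightarrow> \<nu> \<bullet> (z - v) \<ge> 0"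
    "\<And>z. z \<in> K \<Longrightarrow> \<nu> \<bullet> (z - v) = 0 \<Longrightarrow> z \<in> closed_segment v w"
  using assms by (auto simp: edge_normal_def inner_diff_right)

lemma edge_normal_sym:
  assumes "edge_normal K v w \<nu>" shows "edge_normal K w v \<nu>"
proof -
  have "\<nu> \<bullet> (z - w) = \<nu> \<bullet> (z - v)" for z using edge_normalD(3)[OF assms] by (simp add: inner_diff_right)
  thus ?thesis using assms by (auto simp: edge_normal_def closed_segment_commute inner_diff_right)
qed

text \<open>There is a point \<open>s\<close> of \<open>K\<close> that has positive height and does
  not lie ahead of \<open>v\<close> in the direction of the edge. The segment from \<open>s\<close>
  to \<open>w\<close> therefore crosses the normal line at \<open>v\<close> above
  \<open>v\<close>.\<close>

lemma nonacute_raise_vertex: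
  assumes "convex_polygon K" "(v, w) \<in> polygon_edges K" "edge_normal K v w \<nu>" "interior_angle K v \<ge> pi / 2"
  obtains h where "h > 0" "v + h *\<^sub>R \<nu> \<in> K"
proof -
  note K = convex_polygonD[OF assms(1)]
  note E = polygon_edgesD[OF assms(2) K(3)]
  note N = edge_normalD[OF assms(3)]
  obtain s where s: "s \<in> K" "s \<noteq> v" "(s - v) \<bullet> (w - v) \<le> 0"
    using nonacute_vertex_direction[OF assms(1,4) E(2) _ N(2,1,4)] E(3) by metis
  define t where "t = w - v"
  have t0: "t \<noteq> 0" "t \<bullet> t > 0" using E by (auto simp: t_def)
  define \<alpha> where "\<alpha> = ((s - v) \<bullet> t) / (t \<bullet> t)"
  define \<beta> where "\<beta> = (s - v) \<bullet> \<nu>"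
  have dec: "s - v = \<alpha> *\<^sub>R t + \<beta> *\<^sub>R \<nu>"
    unfolding \<alpha>_def \<beta>_def t_def using orthogonal_decomposition[OF N(2,1), of "s - v"] E by simp
  have \<alpha>: "\<alpha> \<le> 0" using s t0 by (simp add: \<alpha>_def t_def divide_nonpos_pos)
  have "\<beta> \<ge> 0" using N(4)[OF s(1)] by (simp add: \<beta>_def inner_commute)
  \<comment> \<open>At height zero \<open>s\<close> would be on the edge, with a tangential
    coordinate both nonnegative and nonpositive, hence equal to \<open>v\<close>.\<close>
  moreover have "\<beta> \<noteq> 0"
  proof
    assume b: "\<beta> = 0"
    hence "s \<in> closed_segment v w" using N(5)[OF s(1)] by (simp add: \<beta>_def inner_commute)
    then obtain u where u: "u \<ge> 0" "s - v = u *\<^sub>R t" by (auto simp: in_segment t_def algebra_simps)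
    hence "\<alpha> = u" using t0 by (simp add: \<alpha>_def)
    hence "u = 0" using u \<alpha> by simp
    thus False using u s by simp
  qed
  ultimately have \<beta>: "\<beta> > 0" by simp
  \<comment> \<open>The weight of \<open>w\<close> that cancels the tangential coordinate
    \<open>(1 - l) * \<alpha> + l\<close>.\<close>
  define l where "l = - \<alpha> / (1 - \<alpha>)"
  have l: "0 \<le> l" "l < 1" "(1 - l) * \<alpha> + l = 0" using \<alpha> by (auto simp: l_def field_simps)
  have "(1 - l) *\<^sub>R s + l *\<^sub>R w = v + (1 - l) *\<^sub>R (s - v) + l *\<^sub>R t" by (simp add: t_def algebra_simps)
  also have "\<dots> = v + ((1 - l) * \<alpha> + l) *\<^sub>R t + ((1 - l) * \<beta>) *\<^sub>R \<nu>" unfolding dec by (simp add: algebra_simps)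
  finally have "v + ((1 - l) * \<beta>) *\<^sub>R \<nu> = (1 - l) *\<^sub>R s + l *\<^sub>R w" using l by simp
  also have "\<dots> \<in> K" using convexD[OF K(2) s(1) E(2)] l by simp
  finally show ?thesis using that[of "(1 - l) * \<beta>"] l \<beta> by simp
qed

text \<open>Both ends of the edge can be raised inside \<open>K\<close>; by convexity the rectangle
  of the smaller of the two heights lies in \<open>K\<close>.\<close>

lemma nonacute_rectangle:
  assumes "convex_polygon K" "(v, w) \<in> polygon_edges K" "edge_normal K v w \<nu>"
    and "\<forall>v. v extreme_point_of K \<longrightarrow> interior_angle K v \<ge> pi / 2"
  obtains h where "h > 0" "\<And>s r. 0 \<le> s \<Longrightarrow> s \<le> 1 \<Longrightarrow> 0 \<le> r \<Longrightarrow> r \<le> h \<Longrightarrow> v + s *\<^sub>R (w - v) + r *\<^sub>R \<nu> \<in> K"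
proof -
  note K = convex_polygonD[OF assms(1)]
  note E = polygon_edgesD[OF assms(2) K(3)]
  have ext: "v extreme_point_of K" "w extreme_point_of K" using assms(2) by (auto simp: polygon_edges_def)
  obtain h1 where h1: "h1 > 0" "v + h1 *\<^sub>R \<nu> \<in> K" using nonacute_raise_vertex[OF assms(1-3)] assms(4) ext by metis
  obtain h2 where h2: "h2 > 0" "w + h2 *\<^sub>R \<nu> \<in> K"
    using nonacute_raise_vertex[OF assms(1) polygon_edges_sym[OF assms(2)] edge_normal_sym[OF assms(3)]] assms(4) ext by metis
  have up: "x + r *\<^sub>R \<nu> \<in> K" if "x \<in> K" "x + h *\<^sub>R \<nu> \<in> K" "0 \<le> r" "r \<le> h" "h > 0" for x r h
  proof -
    have "(1 - r / h) *\<^sub>R x + (r / h) *\<^sub>R (x + h *\<^sub>R \<nu>) \<in> K"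
      using that by (intro convexD[OF K(2)]) auto
    also have "(1 - r / h) *\<^sub>R x + (r / h) *\<^sub>R (x + h *\<^sub>R \<nu>) = x + r *\<^sub>R \<nu>"
      using that by (simp add: algebra_simps)
    finally show ?thesis .
  qed
  show ?thesis
  proof (rule that[of "min h1 h2"])
    show "min h1 h2 > 0" using h1 h2 by simp
    fix s r :: real assume sr: "0 \<le> s" "s \<le> 1" "0 \<le> r" "r \<le> min h1 h2"
    have "v + r *\<^sub>R \<nu> \<in> K" "w + r *\<^sub>R \<nu> \<in> K" using up[OF E(1) h1(2)] up[OF E(2) h2(2)] h1 h2 sr by auto
    hence "(1 - s) *\<^sub>R (v + r *\<^sub>R \<nu>) + s *\<^sub>R (w + r *\<^sub>R \<nu>) \<in> K" using sr by (intro convexD[OF K(2)]) auto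
    thus "v + s *\<^sub>R (w - v) + r *\<^sub>R \<nu> \<in> K" by (simp add: algebra_simps)
  qed
qed

section \<open>Exit points of rays and the edge across the polygon\<close>

text \<open>Compactness yields a last parameter in \<open>K\<close>; from an interior point the ray
  could still be continued.\<close>

lemma ray_exit:
  fixes K :: "complex set"
  assumes "compact K" "y \<in> K" "\<nu> \<noteq> 0"
  obtains h where "h \<ge> 0" "y + h *\<^sub>R \<nu> \<in> frontier K" "\<And>h'. y + h' *\<^sub>R \<nu> \<in> K \<Longrightarrow> h' \<le> h"
proof -
  define H where "H = {h. y + h *\<^sub>R \<nu> \<in> K}"
  have "closed ((\<lambda>h. y + h *\<^sub>R \<nu>) -` K)"
    using compact_imp_closed[OF assms(1)] by (rule continuous_closed_vimage) (intro continuous_intros)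
  moreover have "H = (\<lambda>h. y + h *\<^sub>R \<nu>) -` K" by (auto simp: H_def)
  ultimately have cl: "closed H" by simp
  obtain B where B: "\<And>z. z \<in> K \<Longrightarrow> norm z \<le> B" using compact_imp_bounded[OF assms(1)] by (auto simp: bounded_iff)
  have "\<bar>h\<bar> \<le> (B + norm y) / norm \<nu>" if "h \<in> H" for h
  proof -
    have "\<bar>h\<bar> * norm \<nu> = norm ((y + h *\<^sub>R \<nu>) - y)" by simp
    also have "\<dots> \<le> norm (y + h *\<^sub>R \<nu>) + norm y" by (rule norm_triangle_ineq4)
    also have "\<dots> \<le> B + norm y" using B that by (simp add: H_def)
    finally show ?thesis using assms by (simp add: field_simps)
  qed
  hence "bounded H" by (auto simp: bounded_iff)
  hence "compact H" using cl by (simp add: compact_eq_bounded_closed)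
  moreover have "0 \<in> H" using assms by (simp add: H_def)
  ultimately obtain h where h: "h \<in> H" "\<And>h'. h' \<in> H \<Longrightarrow> h' \<le> h" using compact_attains_sup[of H] by auto
  have "y + h *\<^sub>R \<nu> \<notin> interior K"
  proof
    assume "y + h *\<^sub>R \<nu> \<in> interior K"
    then obtain e where e: "e > 0" "ball (y + h *\<^sub>R \<nu>) e \<subseteq> K" by (auto simp: mem_interior)
    define d where "d = e / 2 / norm \<nu>"
    have d: "d > 0" using e assms by (simp add: d_def)
    have "dist (y + h *\<^sub>R \<nu>) (y + (h + d) *\<^sub>R \<nu>) < e"
      using e assms d by (simp add: dist_norm scaleR_add_left) (simp add: d_def)
    hence "h + d \<in> H" using e by (auto simp: H_def)
    thus False using h(2) d by force
  qed
  hence "y + h *\<^sub>R \<nu> \<in> frontier K" using h closure_subset[of K] by (auto simp: frontier_def H_def)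
  thus ?thesis using that[of h] h \<open>0 \<in> H\<close> by (auto simp: H_def)
qed

text \<open>The exit points of a parallel pencil of rays are distinct, so only finitely many of them are vertices.\<close>

lemma ray_exit_in_edge:
  assumes "convex_polygon K" "infinite A" "\<And>s. s \<in> A \<Longrightarrow> y + s *\<^sub>R t \<in> K" "t \<noteq> 0" "\<nu> \<noteq> 0" "\<nu> \<bullet> t = 0"
  obtains s h a b where "s \<in> A" "h \<ge> 0" "(a, b) \<in> polygon_edges K" "y + s *\<^sub>R t + h *\<^sub>R \<nu> \<in> closed_segment a b"
    "\<And>h'. y + s *\<^sub>R t + h' *\<^sub>R \<nu> \<in> K \<Longrightarrow> h' \<le> h"
proof -
  note K = convex_polygonD[OF assms(1)]
  have "\<exists>h. h \<ge> 0 \<and> y + s *\<^sub>R t + h *\<^sub>R \<nu> \<in> frontier K \<and> (\<forall>h'. y + s *\<^sub>R t + h' *\<^sub>R \<nu> \<in> K \<longrightarrow> h' \<le> h)"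
    if "s \<in> A" for s using ray_exit[OF K(1) assms(3)[OF that] assms(5)] by metis
  then obtain H where H: "\<And>s. s \<in> A \<Longrightarrow> H s \<ge> 0 \<and> y + s *\<^sub>R t + H s *\<^sub>R \<nu> \<in> frontier K \<and> (\<forall>h'. y + s *\<^sub>R t + h' *\<^sub>R \<nu> \<in> K \<longrightarrow> h' \<le> H s)"
    by metis
  have "inj_on (\<lambda>s. y + s *\<^sub>R t + H s *\<^sub>R \<nu>) A"
  proof (rule inj_onI)
    fix s s' assume "y + s *\<^sub>R t + H s *\<^sub>R \<nu> = y + s' *\<^sub>R t + H s' *\<^sub>R \<nu>"
    hence "(s *\<^sub>R t + H s *\<^sub>R \<nu>) \<bullet> t = (s' *\<^sub>R t + H s' *\<^sub>R \<nu>) \<bullet> t" by (simp add: add.assoc)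
    thus "s = s'" using assms by (simp add: inner_add_left)
  qed
  hence "infinite ((\<lambda>s. y + s *\<^sub>R t + H s *\<^sub>R \<nu>) ` A)" using assms(2) finite_imageD by blast
  hence "\<not> (\<lambda>s. y + s *\<^sub>R t + H s *\<^sub>R \<nu>) ` A \<subseteq> {v. v extreme_point_of K}" using K(5) finite_subset by blast
  then obtain s where s: "s \<in> A" "\<not> (y + s *\<^sub>R t + H s *\<^sub>R \<nu>) extreme_point_of K" by auto
  then obtain a b where "(a, b) \<in> polygon_edges K" "y + s *\<^sub>R t + H s *\<^sub>R \<nu> \<in> closed_segment a b"
    using nonextreme_frontier_point_in_edge[OF assms(1)] H by metis
  thus ?thesis using that[of s "H s" a b] s H by auto
qed

text \<open>Vertical rays from a horizontal segment in an inscribed ball must leave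
  \<open>K\<close>, and one of them leaves through an edge.\<close>

lemma polygon_edges_nonempty:
  assumes "convex_polygon K"
  shows "polygon_edges K \<noteq> {}"
proof -
  note K = convex_polygonD[OF assms]
  obtain c e where e: "e > 0" "ball c e \<subseteq> K" using K(4) by (auto simp: mem_interior)
  have "c + s *\<^sub>R 1 \<in> K" if "s \<in> {0<..<e}" for s :: real using that e by (auto simp: dist_norm subset_eq)
  moreover have "infinite {0<..<e}" using e by (simp add: infinite_Ioo)
  moreover have "\<i> \<bullet> 1 = 0" by (simp add: inner_complex_def)
  ultimately show ?thesis using ray_exit_in_edge[OF assms, of "{0<..<e}" c 1 \<i>]
    by (metis complex_i_not_zero empty_iff zero_neq_one)
qed

text \<open>The normal ray from a foot close to \<open>x\<close> exits at a height of at least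
  \<open>h0\<close>, which outweighs the lateral displacement of the foot. An edge through the exit
  point that met the given edge would pass through the interior of the rectangle.\<close>

lemma farther_disjoint_edge_exists:
  assumes "convex_polygon K" "(v, w) \<in> polygon_edges K"
    and "\<forall>v. v extreme_point_of K \<longrightarrow> interior_angle K v \<ge> pi / 2"
    and "x \<in> closed_segment v w"
  obtains a b z where "(a, b) \<in> polygon_edges K" "z \<in> closed_segment a b"
    "closed_segment a b \<inter> closed_segment v w = {}" "dist x v < dist z v" "dist x w < dist z w"
proof -
  note K = convex_polygonD[OF assms(1)]
  note E = polygon_edgesD[OF assms(2) K(3)]
  obtain \<nu> where nu: "edge_normal K v w \<nu>" using edge_normal_exists assms by metis
  note N = edge_normalD[OF nu]
  obtain h0 where h0: "h0 > 0"
    and rect: "\<And>s r. 0 \<le> s \<Longrightarrow> s \<le> 1 \<Longrightarrow> 0 \<le> r \<Longrightarrow> r \<le> h0 \<Longrightarrow> v + s *\<^sub>R (w - v) + r *\<^sub>R \<nu> \<in> K"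
    using nonacute_rectangle[OF assms(1,2) nu assms(3)] by metis
  define t where "t = w - v"
  note rect = rect[folded t_def]
  have t0: "t \<noteq> 0" "t \<bullet> t > 0" using E by (auto simp: t_def)
  have nt: "\<nu> \<bullet> t = 0" "t \<bullet> \<nu> = 0" "\<nu> \<bullet> \<nu> = 1" "\<nu> \<noteq> 0" using N(1,2) by (auto simp: t_def inner_commute norm_eq_1)
  obtain s0 where s0: "0 \<le> s0" "s0 \<le> 1" "x = v + s0 *\<^sub>R t"
    using assms(4) by (auto simp: in_segment t_def algebra_simps)
  \<comment> \<open>A lateral displacement below \<open>\<epsilon>\<close> lowers a squared distance
    to \<open>v\<close> or \<open>w\<close> by less than
    \<open>2 * \<epsilon> * (t \<bullet> t)\<close>, which is \<open>h0\<^sup>2\<close>.\<close>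
  define \<epsilon> where "\<epsilon> = h0\<^sup>2 / (2 * (t \<bullet> t))"
  have eps: "\<epsilon> > 0" "2 * (\<epsilon> * (t \<bullet> t)) = h0\<^sup>2" using h0 t0 by (auto simp: \<epsilon>_def)
  \<comment> \<open>Infinitely many feet, so that some ray avoids the vertices; the ends of the edge
    are excluded so that the foot stays strictly inside the base of the rectangle.\<close>
  define A where "A = {max 0 (s0 - \<epsilon>)<..<min 1 (s0 + \<epsilon>)}"
  have "max 0 (s0 - \<epsilon>) < min 1 (s0 + \<epsilon>)" using s0 eps by auto
  hence "infinite A" by (simp add: A_def infinite_Ioo)
  moreover have "v + s *\<^sub>R t \<in> K" if "s \<in> A" for s using rect[of s 0] that h0 by (auto simp: A_def)
  ultimately obtain s h a b where s: "s \<in> A" and h: "h \<ge> 0" and ab: "(a, b) \<in> polygon_edges K"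
    and z: "v + s *\<^sub>R t + h *\<^sub>R \<nu> \<in> closed_segment a b"
    and top: "\<And>h'. v + s *\<^sub>R t + h' *\<^sub>R \<nu> \<in> K \<Longrightarrow> h' \<le> h"
    using ray_exit_in_edge[OF assms(1), of A v t \<nu>] t0 nt by metis
  have s01: "0 < s" "s < 1" "\<bar>s - s0\<bar> < \<epsilon>" using s by (auto simp: A_def)
  have hh: "h0 \<le> h" using top rect[of s h0] s01 h0 by auto
  define z where "z = v + s *\<^sub>R t + h *\<^sub>R \<nu>"
  have sq: "(norm (p *\<^sub>R t + r *\<^sub>R \<nu>))\<^sup>2 = p\<^sup>2 * (t \<bullet> t) + r\<^sup>2" for p r
    unfolding power2_norm_eq_inner using nt by (simp add: inner_add_left inner_add_right power2_eq_square)
  have key: "norm (p0 *\<^sub>R t) < norm (p *\<^sub>R t + h *\<^sub>R \<nu>)" if p: "\<bar>p0\<bar> \<le> 1" "\<bar>p\<bar> \<le> 1" "\<bar>p - p0\<bar> < \<epsilon>" for p p0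
  proof -
    have "p0\<^sup>2 - p\<^sup>2 = (p0 - p) * (p0 + p)" by (simp add: power2_eq_square algebra_simps)
    also have "\<dots> \<le> \<bar>p0 - p\<bar> * \<bar>p0 + p\<bar>" by (metis abs_ge_self abs_mult)
    also have "\<dots> \<le> \<bar>p0 - p\<bar> * 2" using p by (intro mult_left_mono) auto
    also have "\<dots> < 2 * \<epsilon>" using p by (simp add: abs_minus_commute)
    finally have "(p0\<^sup>2 - p\<^sup>2) * (t \<bullet> t) < 2 * \<epsilon> * (t \<bullet> t)" using t0 by (intro mult_strict_right_mono)
    hence "p0\<^sup>2 * (t \<bullet> t) < p\<^sup>2 * (t \<bullet> t) + h0\<^sup>2" using eps by (simp add: algebra_simps)
    also have "h0\<^sup>2 \<le> h\<^sup>2" using hh h0 by (intro power_mono) auto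
    finally have "(norm (p0 *\<^sub>R t))\<^sup>2 < (norm (p *\<^sub>R t + h *\<^sub>R \<nu>))\<^sup>2" using sq[of p0 0] sq[of p h] by simp
    thus ?thesis by (rule power2_less_imp_less) simp
  qed
  have "x - v = s0 *\<^sub>R t" "z - v = s *\<^sub>R t + h *\<^sub>R \<nu>" "x - w = (s0 - 1) *\<^sub>R t" "z - w = (s - 1) *\<^sub>R t + h *\<^sub>R \<nu>"
    unfolding s0(3) z_def by (auto simp: t_def algebra_simps)
  hence "dist x v < dist z v" "dist x w < dist z w"
    using key[of s0 s] key[of "s0 - 1" "s - 1"] s01 s0 by (auto simp: dist_norm)
  moreover have "closed_segment a b \<inter> closed_segment v w = {}"
  proof (rule ccontr)
    assume "closed_segment a b \<inter> closed_segment v w \<noteq> {}"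
    then obtain u where u: "u \<in> closed_segment a b" "u \<in> closed_segment v w" by auto
    obtain s' where s': "0 \<le> s'" "s' \<le> 1" "u = v + s' *\<^sub>R t" using u(2) by (auto simp: in_segment t_def algebra_simps)
    \<comment> \<open>Small enough that the point \<open>y\<close> between \<open>u\<close> and
      \<open>z\<close> has height below \<open>h0\<close> and so is interior to the
      rectangle.\<close>
    define l where "l = min (1 / 2) (h0 / (2 * h))"
    have l: "0 < l" "l < 1" "l * h < h0"
    proof -
      show "0 < l" "l < 1" using h0 hh by (auto simp: l_def)
      have "l * h \<le> h0 / (2 * h) * h" using h by (intro mult_right_mono) (auto simp: l_def)
      thus "l * h < h0" using h0 hh by simp
    qed
    define y where "y = (1 - l) *\<^sub>R u + l *\<^sub>R z"
    have "y \<in> closed_segment a b"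
      using convexD[OF convex_closed_segment u(1) z[folded z_def], of "1 - l" l] l by (simp add: y_def)
    hence "y \<in> frontier K" using polygon_edgesD(5)[OF ab K(3)] by auto
    then obtain f where f: "f \<noteq> 0" "\<And>k. k \<in> K \<Longrightarrow> f \<bullet> y \<le> f \<bullet> k" using frontier_support K by metis
    define r where "r = (1 - l) * s' + l * s"
    have y: "y = v + r *\<^sub>R t + (l * h) *\<^sub>R \<nu>" by (simp add: y_def z_def s' r_def algebra_simps)
    have "(1 - l) * s' \<le> 1 - l" using s' l by (simp add: mult_left_le)
    moreover have "(1 - l) * s' \<ge> 0" using s' l by simp
    moreover have "l * s > 0" "l * s < l" using l s01 by simp_all
    ultimately have r: "0 < r" "r < 1" unfolding r_def by linarith+
    have lh: "l * h > 0" using l hh h0 by simp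
    \<comment> \<open>The support at \<open>y\<close> is tested at points of the rectangle to the
      left, to the right, below and above; both components of \<open>f\<close> must vanish.\<close>
    have "f \<bullet> y \<le> f \<bullet> (v + 0 *\<^sub>R t + (l * h) *\<^sub>R \<nu>)" "f \<bullet> y \<le> f \<bullet> (v + 1 *\<^sub>R t + (l * h) *\<^sub>R \<nu>)"
         "f \<bullet> y \<le> f \<bullet> (v + r *\<^sub>R t + 0 *\<^sub>R \<nu>)" "f \<bullet> y \<le> f \<bullet> (v + r *\<^sub>R t + h0 *\<^sub>R \<nu>)"
      using r l lh by (intro f(2) rect; simp)+
    hence "r * (f \<bullet> t) \<le> 0" "(1 - r) * (f \<bullet> t) \<ge> 0" "(l * h) * (f \<bullet> \<nu>) \<le> 0" "(h0 - l * h) * (f \<bullet> \<nu>) \<ge> 0"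
      unfolding y by (simp_all add: inner_add_right algebra_simps)
    hence "f \<bullet> t = 0" "f \<bullet> \<nu> = 0" using r l lh hh h0 by (auto simp: mult_le_0_iff zero_le_mult_iff)
    hence "f = 0" using complex_eq_0_if_orthogonal_pair[of \<nu> t f] nt t0 by simp
    thus False using f by simp
  qed
  ultimately show ?thesis using that[OF ab z[folded z_def]] by blast
qed

subsection \<open>Polynomials on a segment\<close>

lemma poly_logarithmic_derivative:
  fixes p :: "complex poly"
  assumes "finite I" "p = smult c (\<Prod>i\<in>I. [:- z i, 1:])" "poly p x \<noteq> 0"
  shows "poly (pderiv p) x = poly p x * (\<Sum>i\<in>I. 1 / (x - z i))"
proof -
  have nz: "x - z i \<noteq> 0" if "i \<in> I" for i
    using assms that by (auto simp: poly_prod)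
  have "poly (pderiv p) x = c * (\<Sum>i\<in>I. \<Prod>j\<in>I - {i}. x - z j)"
    unfolding assms(2) by (simp add: pderiv_smult pderiv_prod poly_sum poly_prod pderiv_pCons)
  also have "(\<Sum>i\<in>I. \<Prod>j\<in>I - {i}. x - z j) = (\<Sum>i\<in>I. (\<Prod>j\<in>I. x - z j) * (1 / (x - z i)))"
    using nz assms(1) by (intro sum.cong refl) (simp add: prod.remove)
  also have "c * \<dots> = poly p x * (\<Sum>i\<in>I. 1 / (x - z i))"
    unfolding assms(2) by (simp add: poly_prod sum_distrib_left)
  finally show ?thesis .
qed

text \<open>Turan's half-plane argument: multiplied by \<open>- \<nu>\<close>, every summand of
  \<open>p' / p\<close> has nonnegative real part, and each summand from \<open>F\<close>
  contributes at least \<open>h / D\<^sup>2\<close>. The factor \<open>\<nu>\<close> does not change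
  the modulus.\<close>

lemma derivative_lower_bound_half_plane:
  fixes p :: "complex poly" and \<nu> :: complex
  assumes "finite I" "p = smult c (\<Prod>i\<in>I. [:- z i, 1:])" "F \<subseteq> I" "norm \<nu> = 1" "h \<ge> 0"
    and "\<And>i. i \<in> I \<Longrightarrow> \<nu> \<bullet> (z i - x) \<ge> 0"
    and "\<And>i. i \<in> F \<Longrightarrow> \<nu> \<bullet> (z i - x) \<ge> h"
    and "\<And>i. i \<in> F \<Longrightarrow> dist x (z i) \<le> D"
  shows "card F * (h / D\<^sup>2) * cmod (poly p x) \<le> cmod (poly (pderiv p) x)"
proof (cases "poly p x = 0")
  case False
  define S where "S = (\<Sum>i\<in>I. 1 / (x - z i))"
  have nz: "x \<noteq> z i" if "i \<in> I" for i
    using assms(1,2) False that by (auto simp: poly_prod)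
  have re: "Re (\<nu> * (- (1 / (x - z i)))) = (\<nu> \<bullet> (z i - x)) / (dist x (z i))\<^sup>2" for i
  proof -
    have "\<nu> * (- (1 / (x - z i))) = \<nu> / (z i - x)"
      by (metis minus_diff_eq minus_divide_right mult.right_neutral times_divide_eq_right)
    also have "Re \<dots> = (\<nu> \<bullet> (z i - x)) / (cmod (z i - x))\<^sup>2"
      by (simp only: Re_divide inner_complex_def cmod_power2)
    finally show ?thesis by (simp add: dist_norm norm_minus_commute)
  qed
  have "card F * (h / D\<^sup>2) = (\<Sum>i\<in>F. h / D\<^sup>2)" by simp
  also have "\<dots> \<le> (\<Sum>i\<in>F. (\<nu> \<bullet> (z i - x)) / (dist x (z i))\<^sup>2)"
  proof (intro sum_mono)
    fix i assume i: "i \<in> F"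
    hence "i \<in> I" using assms(3) by auto
    thus "h / D\<^sup>2 \<le> (\<nu> \<bullet> (z i - x)) / (dist x (z i))\<^sup>2"
      using assms(6,7,8) i nz by (intro frac_le power_mono) auto
  qed
  also have "\<dots> \<le> (\<Sum>i\<in>I. (\<nu> \<bullet> (z i - x)) / (dist x (z i))\<^sup>2)"
    using assms by (intro sum_mono2) auto
  also have "\<dots> = Re (\<nu> * (- S))"
    by (simp only: re[symmetric] S_def sum_negf[symmetric] sum_distrib_left Re_sum)
  also have "\<dots> \<le> cmod (\<nu> * (- S))" by (rule complex_Re_le_cmod)
  also have "\<dots> = cmod S" using assms by (simp add: norm_mult)
  finally have "card F * (h / D\<^sup>2) * cmod (poly p x) \<le> cmod S * cmod (poly p x)"
    by (intro mult_right_mono) auto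
  also have "\<dots> = cmod (poly (pderiv p) x)"
    using poly_logarithmic_derivative[OF assms(1,2) False] by (simp add: S_def norm_mult)
  finally show ?thesis .
qed simp

section \<open>Mean logarithms along a segment\<close>

text \<open>As \<open>sqrt\<close> is odd, an interval of length at most 1 that straddles 0
  contributes at most 1 on each side.\<close>

lemma sqrt_diff_le_2:
  assumes "q \<le> p" "p \<le> q + 1"
  shows "sqrt p - sqrt q \<le> 2"
proof -
  have pos: "sqrt p \<le> sqrt q + 1" if "0 \<le> q" "p \<le> q + 1" for p q :: real
  proof -
    have "sqrt p \<le> sqrt (q + 1)" using that by simp
    also have "\<dots> \<le> sqrt q + sqrt 1" using that by (intro sqrt_add_le_add_sqrt) auto
    finally show ?thesis by simp
  qed
  consider "0 \<le> q" | "p \<le> 0" | "q < 0" "0 < p" by linarith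
  thus ?thesis
  proof cases
    case 1 thus ?thesis using pos[of q p] assms by simp
  next
    case 2 thus ?thesis using pos[of "-p" "-q"] assms by (simp add: real_sqrt_minus)
  next
    case 3
    hence "sqrt p \<le> 1" "sqrt (-q) \<le> 1" using assms unfolding real_sqrt_le_1_iff by linarith+
    thus ?thesis unfolding real_sqrt_minus by linarith
  qed
qed

text \<open>The bound is independent of the position of the singularity \<open>a\<close>, inside or
  outside the interval; this makes the loss per factor uniform in the zeros.\<close>

lemma inverse_sqrt_has_integral:
  assumes "l \<le> u" "u \<le> l + 1" "\<kappa> > 0"
  obtains J where "((\<lambda>t. 1 / sqrt (\<kappa> * \<bar>t - a\<bar>)) has_integral J) {l..u}" "J \<le> 4 / sqrt \<kappa>"
proof -
  \<comment> \<open>HOL's root is odd, hence this primitive of \<open>1 / sqrt \<bar>t - a\<bar>\<close> is valid on both sides of \<open>a\<close>.\<close>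
  define G where "G = (\<lambda>t. 2 * sqrt (t - a))"
  have "((\<lambda>t. 1 / sqrt \<bar>t - a\<bar>) has_integral (G u - G l)) {l..u}"
  proof (rule fundamental_theorem_of_calculus_strong[of "{a}"])
    fix t assume "t \<in> {l..u} - {a}"
    hence "(G has_real_derivative 1 / sqrt \<bar>t - a\<bar>) (at t)"
    proof (cases "t < a")
      case True
      have "G = (\<lambda>t. - 2 * sqrt (a - t))" unfolding G_def using real_sqrt_minus[of "a - _"] by (intro ext) simp
      thus ?thesis using True by (auto intro!: derivative_eq_intros simp: field_simps)
    next
      case False
      thus ?thesis using \<open>t \<in> {l..u} - {a}\<close>
        unfolding G_def by (auto intro!: derivative_eq_intros simp: field_simps)
    qed
    thus "(G has_vector_derivative 1 / sqrt \<bar>t - a\<bar>) (at t)"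
      by (simp add: has_real_derivative_iff_has_vector_derivative)
  qed (auto simp: G_def assms intro!: continuous_intros)
  hence "((\<lambda>t. (1 / sqrt \<kappa>) * (1 / sqrt \<bar>t - a\<bar>)) has_integral ((1 / sqrt \<kappa>) * (G u - G l))) {l..u}"
    by (rule has_integral_mult_right)
  moreover have "(\<lambda>t. (1 / sqrt \<kappa>) * (1 / sqrt \<bar>t - a\<bar>)) = (\<lambda>t. 1 / sqrt (\<kappa> * \<bar>t - a\<bar>))"
    by (simp add: real_sqrt_mult)
  moreover have "(1 / sqrt \<kappa>) * (G u - G l) \<le> (1 / sqrt \<kappa>) * 4"
    using sqrt_diff_le_2[of "l - a" "u - a"] assms by (intro mult_left_mono) (auto simp: G_def)
  ultimately show ?thesis using that by simp
qed

text \<open>A minorant of the logarithm with an explicitly integrable singularity, obtained from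
  \<open>ln s \<le> s - 1\<close> at \<open>s = 1 / sqrt y\<close>.\<close>

lemma ln_ge_inverse_sqrt:
  fixes y :: real
  assumes "y > 0"
  shows "- 2 * (1 / sqrt y) \<le> ln y"
proof -
  have "ln (1 / sqrt y) \<le> 1 / sqrt y - 1" using assms by (intro ln_le_minus_one) simp
  moreover have "ln (1 / sqrt y) = - ln y / 2" using assms by (simp add: ln_div ln_sqrt)
  ultimately show ?thesis by simp
qed

lemma continuous_on_poly_segment_powr:
  fixes p :: "complex poly"
  assumes "q > 0"
  shows "continuous_on A (\<lambda>t::real. cmod (poly p (a + complex_of_real t * (b - a))) powr q)"
  using assms by (intro continuous_on_powr' continuous_intros) auto

text \<open>Jensen's inequality in disguise: \<open>(|p(\<zeta>)| / |p(x)|)\<^sup>q\<close> is bounded from below by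
  \<open>1 + q ln (|p(\<zeta>)| / |p(x)|)\<close>, whose mean over the segment is at least 1, since the logarithmic
  singularities of the few factors in \<open>F\<close> cost less than the gain from the others.\<close>

lemma poly_powr_le_segment_integral:
  fixes p :: "complex poly"
  assumes I: "finite I" "F \<subseteq> I" and p: "p = smult c (\<Prod>i\<in>I. [:- z i, 1:])"
    and t0: "0 \<le> t0" "0 < \<eta>" "t0 + \<eta> \<le> 1" and q: "q > 0" and ab: "a \<noteq> b" and D: "D > 0"
    and near: "\<And>i t. i \<in> I - F \<Longrightarrow> t0 \<le> t \<Longrightarrow> t \<le> t0 + \<eta> \<Longrightarrow>
       (1 + \<eta>) * dist x (z i) \<le> dist (a + t *\<^sub>R (b - a)) (z i)"
    and far: "\<And>i. i \<in> F \<Longrightarrow> dist x (z i) \<le> D"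
    and count: "card F * (8 / sqrt (dist a b / D)) \<le> \<eta> * ln (1 + \<eta>) * card (I - F)"
  shows "\<eta> * cmod (poly p x) powr q \<le>
    integral {0..1} (\<lambda>t. cmod (poly p (a + complex_of_real t * (b - a))) powr q)"
proof -
  define f where "f = (\<lambda>t. cmod (poly p (a + complex_of_real t * (b - a))) powr q)"
  have cont: "continuous_on A f" for A unfolding f_def using q by (rule continuous_on_poly_segment_powr)
  have int: "f integrable_on {l..u}" for l u by (intro integrable_continuous_real cont)
  have f0: "f t \<ge> 0" for t by (simp add: f_def)
  have "\<eta> * cmod (poly p x) powr q \<le> integral {t0..t0+\<eta>} f"
  proof (cases "poly p x = 0")
    case True
    thus ?thesis using q f0 int by (simp add: integral_nonneg)
  next
    case False
    have nz: "dist x (z i) > 0" if "i \<in> I" for i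
      using I p False that by (auto simp: poly_prod)
    have finF: "finite F" using I finite_subset by blast
    define \<kappa> where "\<kappa> = dist a b / D"
    have \<kappa>: "\<kappa> > 0" using ab D by (simp add: \<kappa>_def)
    \<comment> \<open>The parameter of the orthogonal projection of \<open>z i\<close> to the line
      through \<open>a\<close> and \<open>b\<close>; the distance to \<open>z i\<close> is at least
      the distance along the line to this projection.\<close>
    define \<tau> where "\<tau> = (\<lambda>i. ((z i - a) \<bullet> (b - a)) / ((b - a) \<bullet> (b - a)))"
    \<comment> \<open>An integrable minorant of \<open>f\<close> off the projections: factors
      outside \<open>F\<close> gain at least \<open>ln (1 + \<eta>)\<close>, those in
      \<open>F\<close> lose at most an inverse square root.\<close>
    define g where "g = (\<lambda>t. cmod (poly p x) powr q *
       (1 + q * (card (I - F) * ln (1 + \<eta>) - (\<Sum>i\<in>F. 2 * (1 / sqrt (\<kappa> * \<bar>t - \<tau> i\<bar>))))))"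
    define r where "r = (\<lambda>t i. dist (a + t *\<^sub>R (b - a)) (z i) / dist x (z i))"
    have proj: "dist a b * \<bar>t - \<tau> i\<bar> \<le> dist (a + t *\<^sub>R (b - a)) (z i)" for t i
    proof -
      let ?y = "a + t *\<^sub>R (b - a) - z i"
      have bb: "(b - a) \<bullet> (b - a) = dist a b * dist a b"
        by (simp add: dist_norm norm_minus_commute flip: power2_norm_eq_inner power2_eq_square)
      have pos: "dist a b > 0" using ab by simp
      have "\<bar>?y \<bullet> (b - a)\<bar> \<le> norm ?y * norm (b - a)" by (rule Cauchy_Schwarz_ineq2)
      moreover have "\<tau> i * ((b - a) \<bullet> (b - a)) = (z i - a) \<bullet> (b - a)" using ab by (simp add: \<tau>_def)
      hence "?y \<bullet> (b - a) = (t - \<tau> i) * ((b - a) \<bullet> (b - a))"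
        unfolding left_diff_distrib by (simp only: inner_diff_left inner_add_left inner_scaleR_left)
      ultimately have "\<bar>t - \<tau> i\<bar> * (dist a b * dist a b) \<le> norm ?y * dist a b"
        unfolding bb by (simp add: abs_mult dist_norm norm_minus_commute)
      hence "(dist a b * \<bar>t - \<tau> i\<bar>) * dist a b \<le> norm ?y * dist a b" by (simp add: mult_ac)
      thus ?thesis using pos by (simp add: dist_norm mult.commute)
    qed
    have gf: "g t \<le> f t" if t: "t0 \<le> t" "t \<le> t0 + \<eta>" "t \<notin> \<tau> ` F" for t
    proof -
      have rI: "r t i \<ge> 1 + \<eta>" if "i \<in> I - F" for i
        using near[OF that t(1,2)] nz[of i] that by (simp add: r_def field_simps)
      have rF: "r t i \<ge> \<kappa> * \<bar>t - \<tau> i\<bar>" "\<kappa> * \<bar>t - \<tau> i\<bar> > 0" if "i \<in> F" for i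
      proof -
        have "t \<noteq> \<tau> i" using t that by blast
        thus "\<kappa> * \<bar>t - \<tau> i\<bar> > 0" using \<kappa> by simp
        have "\<kappa> * \<bar>t - \<tau> i\<bar> = (dist a b * \<bar>t - \<tau> i\<bar>) / D" by (simp add: \<kappa>_def)
        also have "\<dots> \<le> dist (a + t *\<^sub>R (b - a)) (z i) / dist x (z i)"
          using proj far[OF that] nz[of i] that I by (intro frac_le) auto
        finally show "r t i \<ge> \<kappa> * \<bar>t - \<tau> i\<bar>" by (simp add: r_def)
      qed
      have r0: "r t i > 0" if "i \<in> I" for i
        using rI[of i] rF[of i] that t0 by (cases "i \<in> F") auto
      have "card (I - F) * ln (1 + \<eta>) - (\<Sum>i\<in>F. 2 * (1 / sqrt (\<kappa> * \<bar>t - \<tau> i\<bar>)))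
          = (\<Sum>i\<in>I - F. ln (1 + \<eta>)) + (\<Sum>i\<in>F. - 2 * (1 / sqrt (\<kappa> * \<bar>t - \<tau> i\<bar>)))"
        by (simp add: sum_negf)
      also have "\<dots> \<le> (\<Sum>i\<in>I - F. ln (r t i)) + (\<Sum>i\<in>F. ln (r t i))"
      proof (intro add_mono sum_mono)
        fix i assume i: "i \<in> I - F"
        show "ln (1 + \<eta>) \<le> ln (r t i)" using rI[OF i] t0 by simp
      next
        fix i assume i: "i \<in> F"
        have "- 2 * (1 / sqrt (\<kappa> * \<bar>t - \<tau> i\<bar>)) \<le> ln (\<kappa> * \<bar>t - \<tau> i\<bar>)"
          using rF[OF i] by (intro ln_ge_inverse_sqrt)
        also have "\<dots> \<le> ln (r t i)" using rF[OF i] by simp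
        finally show "- 2 * (1 / sqrt (\<kappa> * \<bar>t - \<tau> i\<bar>)) \<le> ln (r t i)" .
      qed
      also have "\<dots> = (\<Sum>i\<in>I. ln (r t i))" using I by (simp add: sum.subset_diff[OF I(2,1)])
      also have "\<dots> = ln (\<Prod>i\<in>I. r t i)"
      proof (rule ln_prod[symmetric])
        fix i assume "i \<in> I"
        from r0[OF this] show "r t i \<noteq> 0" by simp
      qed (rule I)
      finally have L: "card (I - F) * ln (1 + \<eta>) - (\<Sum>i\<in>F. 2 * (1 / sqrt (\<kappa> * \<bar>t - \<tau> i\<bar>))) \<le> ln (\<Prod>i\<in>I. r t i)" .
      have P0: "(\<Prod>i\<in>I. r t i) > 0" using r0 by (intro prod_pos) auto
      have "1 + q * (card (I - F) * ln (1 + \<eta>) - (\<Sum>i\<in>F. 2 * (1 / sqrt (\<kappa> * \<bar>t - \<tau> i\<bar>))))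
          \<le> 1 + q * ln (\<Prod>i\<in>I. r t i)" using L q by (intro add_left_mono mult_left_mono) auto
      also have "\<dots> \<le> exp (q * ln (\<Prod>i\<in>I. r t i))" by (rule exp_ge_add_one_self)
      also have "\<dots> = (\<Prod>i\<in>I. r t i) powr q" using P0 by (simp add: powr_def)
      finally have "g t \<le> cmod (poly p x) powr q * (\<Prod>i\<in>I. r t i) powr q"
        unfolding g_def by (intro mult_left_mono) auto
      also have "\<dots> = (cmod (poly p x) * (\<Prod>i\<in>I. r t i)) powr q"
        using P0 by (simp add: powr_mult)
      also have "cmod (poly p x) * (\<Prod>i\<in>I. r t i) = cmod (poly p (a + complex_of_real t * (b - a)))"
      proof -
        have "cmod (poly p y) = cmod c * (\<Prod>i\<in>I. dist y (z i))" for y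
          unfolding p by (simp add: poly_prod norm_mult dist_norm prod_norm)
        moreover have "(\<Prod>i\<in>I. dist x (z i)) * (\<Prod>i\<in>I. r t i) = (\<Prod>i\<in>I. dist (a + t *\<^sub>R (b - a)) (z i))"
          using nz by (subst prod.distrib[symmetric]) (intro prod.cong, auto simp: r_def)
        ultimately show ?thesis by (simp add: scaleR_conv_of_real mult.assoc)
      qed
      finally show ?thesis by (simp add: f_def)
    qed
    have "\<exists>J. ((\<lambda>t. 1 / sqrt (\<kappa> * \<bar>t - \<tau> i\<bar>)) has_integral J) {t0..t0+\<eta>} \<and> J \<le> 4 / sqrt \<kappa>" for i
    proof -
      have "t0 \<le> t0 + \<eta>" "t0 + \<eta> \<le> t0 + 1" using t0 by auto
      from inverse_sqrt_has_integral[OF this \<kappa>, of "\<tau> i"] show ?thesis by blast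
    qed
    then obtain J where J: "\<And>i. ((\<lambda>t. 1 / sqrt (\<kappa> * \<bar>t - \<tau> i\<bar>)) has_integral J i) {t0..t0+\<eta>}" "\<And>i. J i \<le> 4 / sqrt \<kappa>"
      by metis
    define R where "R = cmod (poly p x) powr q *
       (\<eta> + q * (\<eta> * (card (I - F) * ln (1 + \<eta>)) - (\<Sum>i\<in>F. 2 * J i)))"
    have c: "((\<lambda>t. w) has_integral (\<eta> * w)) {t0..t0+\<eta>}" for w :: real
      using has_integral_const_real[of w t0 "t0 + \<eta>"] t0 by simp
    have gR: "(g has_integral R) {t0..t0+\<eta>}"
      unfolding g_def R_def using c[of 1]
      by (intro has_integral_mult_right has_integral_add has_integral_diff has_integral_sum finF c J) simp_all
    \<comment> \<open>At a projection the convention \<open>1 / 0 = 0\<close> hides the singularity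
      and \<open>g\<close> may exceed \<open>f\<close>, so \<open>g\<close> is replaced by 0 at
      these finitely many parameters.\<close>
    have "((\<lambda>t. if t \<in> \<tau> ` F then 0 else g t) has_integral R) {t0..t0+\<eta>}"
      by (rule has_integral_spike_finite[OF _ _ gR, of "\<tau> ` F"]) (use finF in auto)
    hence "R \<le> integral {t0..t0+\<eta>} f"
      using gf f0 by (intro has_integral_le[OF _ integrable_integral[OF int]]) auto
    moreover have "cmod (poly p x) powr q * \<eta> \<le> R"
      unfolding R_def
    proof (intro mult_left_mono)
      \<comment> \<open>The 8 in \<open>count\<close> is the 2 from the minorant of the logarithm
        times the 4 from its integral.\<close>
      have "(\<Sum>i\<in>F. 2 * J i) \<le> (\<Sum>i\<in>F. 8 / sqrt \<kappa>)"
        using mult_left_mono[OF J(2), of 2] by (intro sum_mono) simp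
      also have "\<dots> \<le> \<eta> * (card (I - F) * ln (1 + \<eta>))" using count by (simp add: \<kappa>_def mult_ac)
      finally have "q * (\<eta> * (card (I - F) * ln (1 + \<eta>)) - (\<Sum>i\<in>F. 2 * J i)) \<ge> 0" using q by simp
      thus "\<eta> \<le> \<eta> + q * (\<eta> * (card (I - F) * ln (1 + \<eta>)) - (\<Sum>i\<in>F. 2 * J i))" by simp
    qed simp
    ultimately show ?thesis by (simp add: mult.commute)
  qed
  also have "\<dots> \<le> integral {0..1} f"
    using t0 f0 int by (intro integral_subset_le) auto
  finally show ?thesis by (simp add: f_def)
qed

subsection \<open>Uniform constants\<close>

lemma compact_diameter_bound:
  fixes K :: "'a::metric_space set"
  assumes "compact K"
  obtains D where "D > 0" "\<And>x y. x \<in> K \<Longrightarrow> y \<in> K \<Longrightarrow> dist x y \<le> D"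
proof -
  have b: "bounded K" using assms by (rule compact_imp_bounded)
  have "dist x y \<le> diameter K + 1" if "x \<in> K" "y \<in> K" for x y
    using diameter_bounded_bound[OF b that] by simp
  moreover have "diameter K + 1 > 0" using diameter_ge_0[OF b] by linarith
  ultimately show ?thesis using that by blast
qed

lemma finite_common_threshold:
  fixes P :: "'a \<Rightarrow> real \<Rightarrow> bool"
  assumes "finite E" "\<And>e. e \<in> E \<Longrightarrow> \<exists>\<eta>>0. P e \<eta>"
    and "\<And>e \<eta> \<eta>'. P e \<eta> \<Longrightarrow> 0 < \<eta>' \<Longrightarrow> \<eta>' \<le> \<eta> \<Longrightarrow> P e \<eta>'"
  shows "\<exists>\<eta>>0. \<forall>e\<in>E. P e \<eta>"
  using assms(1,2)
proof (induction E)
  case empty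
  show ?case by (intro exI[of _ 1]) simp
next
  case (insert e E)
  then obtain \<eta> where eta: "\<eta> > 0" "\<forall>e\<in>E. P e \<eta>" by auto
  obtain \<eta>' where eta': "\<eta>' > 0" "P e \<eta>'" using insert.prems by auto
  define \<delta> where "\<delta> = min \<eta> \<eta>'"
  have "\<delta> > 0" "\<delta> \<le> \<eta>" "\<delta> \<le> \<eta>'" using eta eta' by (auto simp: \<delta>_def)
  hence "\<forall>x\<in>insert e E. P x \<delta>" using eta eta' assms(3) by blast
  thus ?case using \<open>\<delta> > 0\<close> by blast
qed

text \<open>Finitely many of the balls with a local threshold cover \<open>S\<close>, and
  monotonicity permits a common smaller threshold.\<close>

lemma compact_common_threshold:
  fixes P :: "'a::metric_space \<Rightarrow> real \<Rightarrow> bool"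
  assumes "compact S" "\<And>x. x \<in> S \<Longrightarrow> \<exists>r>0. \<exists>\<eta>>0. \<forall>y\<in>S. dist x y < r \<longrightarrow> P y \<eta>"
    and mono: "\<And>x \<eta> \<eta>'. P x \<eta> \<Longrightarrow> 0 < \<eta>' \<Longrightarrow> \<eta>' \<le> \<eta> \<Longrightarrow> P x \<eta>'"
  shows "\<exists>\<eta>>0. \<forall>x\<in>S. P x \<eta>"
proof -
  obtain r where r: "\<And>x. x \<in> S \<Longrightarrow> r x > 0 \<and> (\<exists>\<eta>>0. \<forall>y\<in>S. dist x y < r x \<longrightarrow> P y \<eta>)"
    using assms(2) by metis
  obtain T where T: "T \<subseteq> S" "finite T" "S \<subseteq> (\<Union>x\<in>T. ball x (r x))"
  proof (rule compactE_image[OF assms(1), of S "\<lambda>x. ball x (r x)"])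
    show "S \<subseteq> (\<Union>x\<in>S. ball x (r x))"
    proof
      fix x assume "x \<in> S"
      thus "x \<in> (\<Union>x\<in>S. ball x (r x))" using r[of x] by (intro UN_I[of x]) auto
    qed
  qed auto
  have "\<exists>\<eta>>0. \<forall>x\<in>T. \<forall>y\<in>S. dist x y < r x \<longrightarrow> P y \<eta>"
  proof (rule finite_common_threshold[OF T(2)])
    fix x assume "x \<in> T"
    thus "\<exists>\<eta>>0. \<forall>y\<in>S. dist x y < r x \<longrightarrow> P y \<eta>" using r[of x] T(1) by blast
  next
    fix x \<eta> \<eta>' assume "\<forall>y\<in>S. dist x y < r x \<longrightarrow> P y \<eta>" "0 < \<eta>'" "\<eta>' \<le> \<eta>"
    thus "\<forall>y\<in>S. dist x y < r x \<longrightarrow> P y \<eta>'" using mono[of _ \<eta> \<eta>'] by simp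
  qed
  then obtain \<eta> where eta: "\<eta> > 0" "\<forall>x\<in>T. \<forall>y\<in>S. dist x y < r x \<longrightarrow> P y \<eta>" by blast
  have "P y \<eta>" if y: "y \<in> S" for y
  proof -
    obtain x where "x \<in> T" "dist x y < r x" using T(3) y by auto
    thus ?thesis using eta y by blast
  qed
  thus ?thesis using eta by blast
qed

section \<open>Boundary pieces uniformly farther from the neighbourhood of an edge\<close>

text \<open>The difference of the squared distances to \<open>z\<close> and \<open>x\<close> is
  affine in the point, so its bound at \<open>v\<close> and \<open>w\<close> holds on the segment.
  Leaving the segment by \<open>\<delta>\<close> costs at most
  \<open>2 * D * \<delta>\<close>.\<close>

lemma farther_from_segment_neighbourhood:
  fixes x z v w u y :: complex
  assumes m: "m > 0" "dist x v + m \<le> dist z v" "dist x w + m \<le> dist z w"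
    and u: "u \<in> closed_segment v w" and y: "dist y u \<le> \<delta>" and D: "dist x z \<le> D" "D \<ge> 0"
  shows "(dist x y)\<^sup>2 + m\<^sup>2 - 2 * D * \<delta> \<le> (dist z y)\<^sup>2"
proof -
  define g where "g = (\<lambda>u. (dist z u)\<^sup>2 - (dist x u)\<^sup>2)"
  have g: "g u = z \<bullet> z - x \<bullet> x - 2 * ((z - x) \<bullet> u)" for u
    unfolding g_def dist_norm power2_norm_eq_inner by (simp add: inner_diff_left inner_diff_right inner_commute)
  have sq: "m\<^sup>2 \<le> q\<^sup>2 - p\<^sup>2" if "0 \<le> p" "p + m \<le> q" for p q :: real
  proof -
    have "(p + m)\<^sup>2 \<le> q\<^sup>2" using that m by (intro power_mono) auto
    moreover have "(p + m)\<^sup>2 = p\<^sup>2 + m\<^sup>2 + 2 * p * m" by (simp add: power2_sum)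
    moreover have "2 * p * m \<ge> 0" using that m by simp
    ultimately show ?thesis by linarith
  qed
  have gv: "g v \<ge> m\<^sup>2" "g w \<ge> m\<^sup>2"
    unfolding g_def using sq[of "dist x v" "dist z v"] sq[of "dist x w" "dist z w"] m by simp_all
  obtain l where l: "0 \<le> l" "l \<le> 1" "u = (1 - l) *\<^sub>R v + l *\<^sub>R w" using u by (auto simp: in_segment)
  have "m\<^sup>2 = (1 - l) * m\<^sup>2 + l * m\<^sup>2" by (simp add: algebra_simps)
  also have "\<dots> \<le> (1 - l) * g v + l * g w" using gv l by (intro add_mono mult_left_mono) auto
  also have "\<dots> = g u" unfolding g l(3) by (simp add: inner_add_right algebra_simps)
  also have "g u = g y + 2 * ((z - x) \<bullet> (y - u))" unfolding g by (simp add: inner_diff_right)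
  also have "(z - x) \<bullet> (y - u) \<le> norm (z - x) * norm (y - u)" by (rule norm_cauchy_schwarz)
  also have "\<dots> \<le> D * \<delta>" using y D by (intro mult_mono) (auto simp: dist_norm norm_minus_commute)
  finally show ?thesis by (simp add: g_def)
qed

text \<open>The single \<open>\<eta>\<close> serves as length of the parameter window, width of the
  neighbourhood and gain factor, so that the property is monotone in one threshold.\<close>

definition escapes :: "complex set \<Rightarrow> complex \<Rightarrow> complex \<Rightarrow> complex \<Rightarrow> real \<Rightarrow> bool" where
  "escapes K v w x \<eta> \<longleftrightarrow> (\<exists>a b t0. (a, b) \<in> polygon_edges K \<and> closed_segment a b \<inter> closed_segment v w = {}
     \<and> 0 \<le> t0 \<and> t0 + \<eta> \<le> 1 \<and> (\<forall>t y. t0 \<le> t \<longrightarrow> t \<le> t0 + \<eta> \<longrightarrow> y \<in> K \<longrightarrow>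
          (\<exists>u\<in>closed_segment v w. dist y u \<le> \<eta>) \<longrightarrow> (1 + \<eta>) * dist x y \<le> dist (a + t *\<^sub>R (b - a)) y))"

lemma escapes_mono:
  assumes "escapes K v w x \<eta>" "0 < \<eta>'" "\<eta>' \<le> \<eta>"
  shows "escapes K v w x \<eta>'"
proof -
  obtain a b t0 where ab: "(a, b) \<in> polygon_edges K" "closed_segment a b \<inter> closed_segment v w = {}"
     "0 \<le> t0" "t0 + \<eta> \<le> 1" and
     e: "\<And>t y. t0 \<le> t \<Longrightarrow> t \<le> t0 + \<eta> \<Longrightarrow> y \<in> K \<Longrightarrow>
          \<exists>u\<in>closed_segment v w. dist y u \<le> \<eta> \<Longrightarrow> (1 + \<eta>) * dist x y \<le> dist (a + t *\<^sub>R (b - a)) y"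
    using assms(1) unfolding escapes_def by metis
  have "(1 + \<eta>') * dist x y \<le> dist (a + t *\<^sub>R (b - a)) y"
    if "t0 \<le> t" "t \<le> t0 + \<eta>'" "y \<in> K" "\<exists>u\<in>closed_segment v w. dist y u \<le> \<eta>'" for t y
  proof -
    have "(1 + \<eta>') * dist x y \<le> (1 + \<eta>) * dist x y" using assms by (intro mult_right_mono) auto
    also have "\<dots> \<le> dist (a + t *\<^sub>R (b - a)) y"
    proof (rule e)
      show "\<exists>u\<in>closed_segment v w. dist y u \<le> \<eta>" using that(4) assms(3) order_trans by blast
    qed (use that assms in auto)
    finally show ?thesis .
  qed
  moreover have "t0 + \<eta>' \<le> 1" using ab assms by simp
  ultimately show ?thesis unfolding escapes_def using ab by blast
qed

text \<open>The strict inequalities between \<open>x\<close> and the point \<open>z\<close> across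
  \<open>K\<close> have a margin, which survives small changes of \<open>x\<close>, of
  \<open>z\<close> along its edge and of the points near the given edge.\<close>

lemma escapes_local:
  assumes "convex_polygon K" "(v, w) \<in> polygon_edges K"
    and "\<forall>v. v extreme_point_of K \<longrightarrow> interior_angle K v \<ge> pi / 2"
    and "x \<in> closed_segment v w"
  shows "\<exists>r>0. \<exists>\<eta>>0. \<forall>x'\<in>closed_segment v w. dist x x' < r \<longrightarrow> escapes K v w x' \<eta>"
proof -
  note K = convex_polygonD[OF assms(1)]
  note E = polygon_edgesD[OF assms(2) K(3)]
  obtain a b z where ab: "(a, b) \<in> polygon_edges K" "closed_segment a b \<inter> closed_segment v w = {}"
    and z: "z \<in> closed_segment a b" "dist x v < dist z v" "dist x w < dist z w"
    using farther_disjoint_edge_exists[OF assms] by metis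
  note E' = polygon_edgesD[OF ab(1) K(3)]
  obtain D where D: "D > 0" "\<And>x y. x \<in> K \<Longrightarrow> y \<in> K \<Longrightarrow> dist x y \<le> D"
    using compact_diameter_bound[OF K(1)] by blast
  obtain t1 where t1: "0 \<le> t1" "t1 \<le> 1" "z = a + t1 *\<^sub>R (b - a)"
    using z(1) by (auto simp: in_segment algebra_simps)
  define m where "m = min (dist z v - dist x v) (dist z w - dist x w) / 2"
  have m: "m > 0" "dist x v + 2 * m \<le> dist z v" "dist x w + 2 * m \<le> dist z w" using z by (auto simp: m_def)
  \<comment> \<open>In order: the window fits into the unit interval; its points stay within
    \<open>m / 2\<close> of \<open>z\<close>; leaving the segment costs at most half of
    \<open>m\<^sup>2\<close>; the factor \<open>1 + \<eta>\<close> costs at most the other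
    half.\<close>
  define \<eta> where "\<eta> = min (1 / 2) (min (m / (2 * D)) (min (m\<^sup>2 / (4 * D)) (m\<^sup>2 / (6 * D\<^sup>2))))"
  have eta: "\<eta> > 0" "\<eta> \<le> 1 / 2" "\<eta> * D \<le> m / 2" "2 * D * \<eta> \<le> m\<^sup>2 / 2" "3 * \<eta> * D\<^sup>2 \<le> m\<^sup>2 / 2"
  proof -
    show "\<eta> > 0" "\<eta> \<le> 1 / 2" using m D by (auto simp: \<eta>_def)
    have "\<eta> \<le> m / (2 * D)" "\<eta> \<le> m\<^sup>2 / (4 * D)" "\<eta> \<le> m\<^sup>2 / (6 * D\<^sup>2)" by (simp_all add: \<eta>_def)
    thus "\<eta> * D \<le> m / 2" "2 * D * \<eta> \<le> m\<^sup>2 / 2" "3 * \<eta> * D\<^sup>2 \<le> m\<^sup>2 / 2" using D by (simp_all add: field_simps)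
  qed
  \<comment> \<open>The window extends from \<open>t1\<close> to the side on which it remains in the
    unit interval.\<close>
  define t0 where "t0 = (if t1 \<le> 1 / 2 then t1 else t1 - \<eta>)"
  have t0: "0 \<le> t0" "t0 + \<eta> \<le> 1" "t0 \<le> t1" "t1 \<le> t0 + \<eta>" using t1 eta by (auto simp: t0_def)
  have "escapes K v w x' \<eta>" if x': "x' \<in> closed_segment v w" "dist x x' < m / 2" for x'
  proof -
    have "(1 + \<eta>) * dist x' y \<le> dist (a + t *\<^sub>R (b - a)) y"
      if t: "t0 \<le> t" "t \<le> t0 + \<eta>" and y: "y \<in> K" "u \<in> closed_segment v w" "dist y u \<le> \<eta>" for t y u
    proof -
      define \<zeta> where "\<zeta> = a + t *\<^sub>R (b - a)"
      have "\<zeta> = (1 - t) *\<^sub>R a + t *\<^sub>R b" by (simp add: \<zeta>_def algebra_simps)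
      hence "\<zeta> \<in> closed_segment a b" unfolding in_segment using t t0 by (intro exI[of _ t]) auto
      hence zK: "\<zeta> \<in> K" using E'(4) by auto
      have xK: "x' \<in> K" using E(4) x' by auto
      have "dist z \<zeta> = \<bar>t1 - t\<bar> * dist a b"
      proof -
        have "z - \<zeta> = (t1 - t) *\<^sub>R (b - a)" by (simp add: t1(3) \<zeta>_def algebra_simps)
        thus ?thesis by (simp add: dist_norm norm_minus_commute)
      qed
      also have "\<dots> \<le> \<eta> * D" using t t0 D(2)[OF E'(1,2)] by (intro mult_mono) auto
      also have "\<dots> \<le> m / 2" using eta by simp
      finally have zz: "dist z \<zeta> \<le> m / 2" .
      \<comment> \<open>Of the margin \<open>2 * m\<close>, at most \<open>m / 2\<close> is lost in
        moving \<open>x\<close> and \<open>m / 2\<close> in moving \<open>z\<close>.\<close>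
      have close: "dist x' p + m \<le> dist \<zeta> p" if "dist x p + 2 * m \<le> dist z p" for p
        using dist_triangle[of x' p x] dist_triangle[of z p \<zeta>] zz x' that by (simp add: dist_commute)
      have "(dist x' y)\<^sup>2 + m\<^sup>2 - 2 * D * \<eta> \<le> (dist \<zeta> y)\<^sup>2"
        using m D close zK xK y by (intro farther_from_segment_neighbourhood[where u = u]) auto
      hence lower: "(dist x' y)\<^sup>2 + m\<^sup>2 / 2 \<le> (dist \<zeta> y)\<^sup>2" using eta by linarith
      have "((1 + \<eta>) * dist x' y)\<^sup>2 = (dist x' y)\<^sup>2 + (2 * \<eta> + \<eta> * \<eta>) * (dist x' y)\<^sup>2"
        by (simp add: power_mult_distrib power2_sum power2_eq_square algebra_simps)
      also have "(2 * \<eta> + \<eta> * \<eta>) * (dist x' y)\<^sup>2 \<le> (3 * \<eta>) * D\<^sup>2"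
      proof (intro mult_mono power_mono)
        have "\<eta> * \<eta> \<le> \<eta> * 1" using eta by (intro mult_left_mono) auto
        thus "2 * \<eta> + \<eta> * \<eta> \<le> 3 * \<eta>" by simp
      qed (use D(2)[OF xK y(1)] eta in auto)
      also have "\<dots> \<le> m\<^sup>2 / 2" using eta by simp
      finally have "((1 + \<eta>) * dist x' y)\<^sup>2 \<le> (dist \<zeta> y)\<^sup>2" using lower by simp
      thus ?thesis unfolding \<zeta>_def by (rule power2_le_imp_le) simp
    qed
    thus ?thesis unfolding escapes_def using ab t0(1,2) by blast
  qed
  thus ?thesis using m eta by (intro exI[of _ "m / 2"] conjI exI[of _ \<eta>]) auto
qed

text \<open>Compactness of each edge makes the local threshold uniform along it, and there are
  finitely many edges.\<close>

lemma escapes_uniformly: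
  assumes "convex_polygon K" "\<forall>v. v extreme_point_of K \<longrightarrow> interior_angle K v \<ge> pi / 2"
  obtains \<eta> where "\<eta> > 0" "\<And>v w x. (v, w) \<in> polygon_edges K \<Longrightarrow> x \<in> closed_segment v w \<Longrightarrow> escapes K v w x \<eta>"
proof -
  note K = convex_polygonD[OF assms(1)]
  have "\<exists>\<eta>>0. \<forall>x\<in>closed_segment v w. escapes K v w x \<eta>" if "(v, w) \<in> polygon_edges K" for v w
    by (rule compact_common_threshold[OF compact_segment escapes_local[OF assms(1) that assms(2)] escapes_mono])
  hence "\<exists>\<eta>>0. \<forall>e\<in>polygon_edges K. \<forall>x\<in>closed_segment (fst e) (snd e). escapes K (fst e) (snd e) x \<eta>"
  proof (rule finite_common_threshold[OF K(6)])
    fix e \<eta> \<eta>' assume "\<forall>x\<in>closed_segment (fst e) (snd e). escapes K (fst e) (snd e) x \<eta>" "0 < \<eta>'" "\<eta>' \<le> (\<eta>::real)"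
    thus "\<forall>x\<in>closed_segment (fst e) (snd e). escapes K (fst e) (snd e) x \<eta>'"
      using escapes_mono[of K "fst e" "snd e" _ \<eta> \<eta>'] by simp
  qed auto
  then obtain \<eta> where eta: "\<eta> > 0" "\<forall>e\<in>polygon_edges K. \<forall>x\<in>closed_segment (fst e) (snd e). escapes K (fst e) (snd e) x \<eta>"
    by blast
  have "escapes K v w x \<eta>" if "(v, w) \<in> polygon_edges K" "x \<in> closed_segment v w" for v w x
    using bspec[OF eta(2) that(1)] that(2) by simp
  thus ?thesis by (rule that[OF eta(1)])
qed

lemma disjoint_edges_separated:
  assumes "convex_polygon K"
  obtains d where "d > 0" "\<And>v w a b x y. (v, w) \<in> polygon_edges K \<Longrightarrow> (a, b) \<in> polygon_edges K \<Longrightarrow>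
    closed_segment a b \<inter> closed_segment v w = {} \<Longrightarrow> x \<in> closed_segment v w \<Longrightarrow> y \<in> closed_segment a b \<Longrightarrow> d \<le> dist x y"
proof -
  note K = convex_polygonD[OF assms(1)]
  define P :: "(complex \<times> complex) \<times> (complex \<times> complex) \<Rightarrow> real \<Rightarrow> bool"
    where "P = (\<lambda>((v, w), (a, b)) d. closed_segment a b \<inter> closed_segment v w = {} \<longrightarrow>
    (\<forall>x\<in>closed_segment v w. \<forall>y\<in>closed_segment a b. d \<le> dist x y))"
  have "\<exists>d>0. \<forall>e\<in>polygon_edges K \<times> polygon_edges K. P e d"
  proof (rule finite_common_threshold)
    show "finite (polygon_edges K \<times> polygon_edges K)" using K by simp
    fix e assume "e \<in> polygon_edges K \<times> polygon_edges K"
    obtain v w a b where e: "e = ((v, w), (a, b))" by (metis prod.collapse)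
    show "\<exists>d>0. P e d"
    proof (cases "closed_segment a b \<inter> closed_segment v w = {}")
      case True
      then obtain d where "d > 0" "\<forall>x\<in>closed_segment v w. \<forall>y\<in>closed_segment a b. d \<le> dist x y"
        using separate_compact_closed[of "closed_segment v w" "closed_segment a b"] by auto
      thus ?thesis unfolding P_def e by auto
    qed (auto simp: P_def e intro!: exI[of _ 1])
  next
    fix e d d' assume *: "P e d" "0 < d'" "d' \<le> (d::real)"
    obtain v w a b where e: "e = ((v, w), (a, b))" by (metis prod.collapse)
    show "P e d'" using * unfolding P_def e by (simp, meson order_trans)
  qed
  then obtain d where d: "d > 0" "\<forall>e\<in>polygon_edges K \<times> polygon_edges K. P e d" by blast
  have "P ((v, w), (a, b)) d" if "(v, w) \<in> polygon_edges K" "(a, b) \<in> polygon_edges K" for v w a b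
    using d that by blast
  thus ?thesis using that[OF d(1)] unfolding P_def by simp
qed

text \<open>The height over an edge is continuous, and it is positive on the compact set of points
  away from the edge because the supporting line meets \<open>K\<close> only in the edge.\<close>

lemma height_lower_bound:
  assumes "convex_polygon K" "\<eta> > 0"
  obtains h where "h > 0" "\<And>v w. (v, w) \<in> polygon_edges K \<Longrightarrow> \<exists>\<nu>. edge_normal K v w \<nu> \<and>
    (\<forall>y\<in>K. (\<forall>u\<in>closed_segment v w. \<eta> < dist y u) \<longrightarrow> h \<le> \<nu> \<bullet> (y - v))"
proof -
  note K = convex_polygonD[OF assms(1)]
  define P where "P = (\<lambda>(v, w) h. \<exists>\<nu>. edge_normal K v w \<nu> \<and>
    (\<forall>y\<in>K. (\<forall>u\<in>closed_segment v w. \<eta> < dist y u) \<longrightarrow> h \<le> \<nu> \<bullet> (y - v)))"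
  have "\<exists>h>0. \<forall>e\<in>polygon_edges K. P e h"
  proof (rule finite_common_threshold)
    fix e assume "e \<in> polygon_edges K"
    then obtain v w where e: "e = (v, w)" "(v, w) \<in> polygon_edges K" by (metis prod.collapse)
    obtain \<nu> where nu: "edge_normal K v w \<nu>" using edge_normal_exists assms(1) e(2) by metis
    \<comment> \<open>The weak inequality makes the set closed; it contains all points of
      \<open>K\<close> satisfying the strict one.\<close>
    define Y where "Y = K \<inter> (\<Inter>u\<in>closed_segment v w. {y. \<eta> \<le> dist y u})"
    have Y: "compact Y" unfolding Y_def
      by (intro compact_Int_closed K closed_INT ballI closed_Collect_le continuous_intros)
    have pos: "\<nu> \<bullet> (y - v) > 0" if "y \<in> Y" for y
    proof -
      have "y \<in> K" "y \<notin> closed_segment v w" using that assms(2) by (auto simp: Y_def)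
      thus ?thesis using edge_normalD(4,5)[OF nu, of y] by linarith
    qed
    have "\<exists>h>0. \<forall>y\<in>Y. h \<le> \<nu> \<bullet> (y - v)"
    proof (cases "Y = {}")
      case False
      have "continuous_on Y (\<lambda>y. \<nu> \<bullet> (y - v))" by (intro continuous_intros)
      then obtain y0 where "y0 \<in> Y" "\<forall>y\<in>Y. \<nu> \<bullet> (y0 - v) \<le> \<nu> \<bullet> (y - v)"
        using continuous_attains_inf[OF Y False] by blast
      thus ?thesis using pos by blast
    qed (auto intro: exI[of _ 1])
    then obtain h where h: "h > 0" "\<forall>y\<in>Y. h \<le> \<nu> \<bullet> (y - v)" by blast
    have "\<forall>y\<in>K. (\<forall>u\<in>closed_segment v w. \<eta> < dist y u) \<longrightarrow> h \<le> \<nu> \<bullet> (y - v)"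
      using h(2) by (auto simp: Y_def less_imp_le)
    thus "\<exists>h>0. P e h" using nu h(1) unfolding P_def e by auto
  next
    fix e h h' assume *: "P e h" "0 < h'" "h' \<le> (h::real)"
    obtain v w where e: "e = (v, w)" by (metis prod.collapse)
    obtain \<nu> where "edge_normal K v w \<nu>" "\<forall>y\<in>K. (\<forall>u\<in>closed_segment v w. \<eta> < dist y u) \<longrightarrow> h \<le> \<nu> \<bullet> (y - v)"
      using * unfolding P_def e by auto
    hence "edge_normal K v w \<nu> \<and> (\<forall>y\<in>K. (\<forall>u\<in>closed_segment v w. \<eta> < dist y u) \<longrightarrow> h' \<le> \<nu> \<bullet> (y - v))"
      using *(3) by (meson order_trans)
    thus "P e h'" unfolding P_def e by blast
  qed (rule K)
  then obtain h where h: "h > 0" "\<forall>e\<in>polygon_edges K. P e h" by blast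
  have "P (v, w) h" if "(v, w) \<in> polygon_edges K" for v w using h(2) that by blast
  thus ?thesis using that[OF h(1)] unfolding P_def by simp
qed

subsection \<open>The oscillation inequality\<close>

lemma min_edge_length:
  assumes "convex_polygon K"
  obtains \<mu> where "\<mu> > 0" "\<And>v w. (v, w) \<in> polygon_edges K \<Longrightarrow> \<mu> \<le> dist v w"
proof -
  note K = convex_polygonD[OF assms]
  have "\<exists>\<mu>>0. \<forall>e\<in>polygon_edges K. \<mu> \<le> dist (fst e) (snd e)"
  proof (rule finite_common_threshold[OF K(6)])
    fix e assume "e \<in> polygon_edges K"
    hence "dist (fst e) (snd e) > 0" by (auto simp: polygon_edges_def)
    thus "\<exists>\<mu>>0. \<mu> \<le> dist (fst e) (snd e)" by blast
  qed auto
  then obtain \<mu> where l: "\<mu> > 0" "\<forall>e\<in>polygon_edges K. \<mu> \<le> dist (fst e) (snd e)" by blast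
  have "\<mu> \<le> dist v w" if "(v, w) \<in> polygon_edges K" for v w using bspec[OF l(2) that] by simp
  thus ?thesis by (rule that[OF l(1)])
qed

lemma polys_in_indexed_roots:
  assumes "p \<in> polys_in K n" "p \<noteq> 0"
  obtains z where "p = smult (lead_coeff p) (\<Prod>i<n. [:- z i, 1:])" "\<And>i. i < n \<Longrightarrow> z i \<in> K"
proof -
  obtain z where "smult (lead_coeff p) (\<Prod>i<degree p. [:- z i, 1:]) = p" by (rule complex_poly_decompose')
  hence z: "p = smult (lead_coeff p) (\<Prod>i<n. [:- z i, 1:])" using assms by (simp add: polys_in_def)
  have "z i \<in> K" if "i < n" for i
  proof -
    have "poly p (z i) = 0" by (subst z) (use that in \<open>auto simp: poly_prod\<close>)
    thus ?thesis using assms by (simp add: polys_in_def)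
  qed
  thus ?thesis using that z by blast
qed

section \<open>Means over edges and comparison of the boundary integrals\<close>

text \<open>Normalised to the unit parameter interval; the factor \<open>dist v w\<close> turns it
  into the arc length integral.\<close>

definition edge_mean :: "real \<Rightarrow> complex poly \<Rightarrow> complex \<Rightarrow> complex \<Rightarrow> real" where
  "edge_mean q p v w = integral {0..1} (\<lambda>t. cmod (poly p (v + complex_of_real t * (w - v))) powr q)"

lemma edge_mean_nonneg: "q > 0 \<Longrightarrow> edge_mean q p v w \<ge> 0"
  unfolding edge_mean_def
  by (intro integral_nonneg integrable_continuous_real continuous_on_poly_segment_powr) auto

text \<open>A vanishing mean would give the polynomial infinitely many zeros on the segment.\<close>

lemma edge_mean_pos:
  assumes "p \<noteq> 0" "q > 0" "v \<noteq> w"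
  shows "edge_mean q p v w > 0"
proof (rule ccontr)
  let ?f = "\<lambda>t. cmod (poly p (v + complex_of_real t * (w - v))) powr q"
  assume "\<not> edge_mean q p v w > 0"
  hence "integral {0..1} ?f = 0" using edge_mean_nonneg[OF assms(2), of p v w] by (simp add: edge_mean_def)
  hence "\<forall>t\<in>{0..1}. ?f t = 0"
    using integral_eq_0_iff[of 0 1 ?f] continuous_on_poly_segment_powr[OF assms(2)] by simp
  hence "(\<lambda>t::real. v + complex_of_real t * (w - v)) ` {0..1} \<subseteq> {z. poly p z = 0}" by auto
  moreover have "finite {z. poly p z = 0}" using poly_roots_finite[OF assms(1)] .
  ultimately have "finite ((\<lambda>t::real. v + complex_of_real t * (w - v)) ` {0..1})" by (rule finite_subset)
  moreover have "inj_on (\<lambda>t::real. v + complex_of_real t * (w - v)) {0..1}"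
    using assms by (auto simp: inj_on_def)
  ultimately have "finite {0..1::real}" by (rule finite_imageD)
  thus False by (simp add: infinite_Icc)
qed

lemma edge_mean_mono:
  assumes "q > 0" "c \<ge> 0" "\<And>x. x \<in> closed_segment v w \<Longrightarrow> c * cmod (poly p x) \<le> cmod (poly r x)"
  shows "c powr q * edge_mean q p v w \<le> edge_mean q r v w"
proof -
  have i: "(\<lambda>t. cmod (poly p (v + complex_of_real t * (w - v))) powr q) integrable_on {0..1}" for p
    by (intro integrable_continuous_real continuous_on_poly_segment_powr assms)
  have "c powr q * cmod (poly p (v + complex_of_real t * (w - v))) powr q
      \<le> cmod (poly r (v + complex_of_real t * (w - v))) powr q" if "t \<in> {0..1}" for t
  proof -
    have "v + complex_of_real t * (w - v) \<in> closed_segment v w"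
      unfolding in_segment using that by (intro exI[of _ t]) (auto simp: scaleR_conv_of_real algebra_simps)
    from assms(3)[OF this] have "(c * cmod (poly p (v + complex_of_real t * (w - v)))) powr q
      \<le> cmod (poly r (v + complex_of_real t * (w - v))) powr q" using assms by (intro powr_mono2) auto
    thus ?thesis using assms by (simp add: powr_mult)
  qed
  hence "integral {0..1} (\<lambda>t. c powr q * cmod (poly p (v + complex_of_real t * (w - v))) powr q) \<le> edge_mean q r v w"
    unfolding edge_mean_def using i
    by (intro integral_le integrable_continuous_real continuous_on_mult_left continuous_on_poly_segment_powr assms) auto
  thus ?thesis by (simp add: edge_mean_def)
qed

lemma edge_mean_le:
  assumes "q > 0" "\<And>x. x \<in> closed_segment v w \<Longrightarrow> cmod (poly p x) powr q \<le> B"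
  shows "edge_mean q p v w \<le> B"
proof -
  have "edge_mean q p v w \<le> integral {0..1::real} (\<lambda>_. B)" unfolding edge_mean_def
  proof (intro integral_le integrable_continuous_real continuous_on_poly_segment_powr assms)
    fix t :: real assume t: "t \<in> {0..1}"
    show "v + complex_of_real t * (w - v) \<in> closed_segment v w"
      unfolding in_segment using t by (intro exI[of _ t]) (auto simp: scaleR_conv_of_real algebra_simps)
  qed auto
  thus ?thesis by simp
qed

lemma boundary_integral_poly:
  "boundary_integral K (\<lambda>z. cmod (poly p z) powr q) =
     (\<Sum>(v, w)\<in>polygon_edges K. edge_mean q p v w * dist v w) / 2"
  unfolding boundary_integral_def edge_mean_def by (simp add: dist_norm norm_minus_commute)

text \<open>Indices instead of zeros, so that cardinalities count multiplicity.\<close>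

definition far_roots :: "real \<Rightarrow> nat \<Rightarrow> (nat \<Rightarrow> complex) \<Rightarrow> complex \<Rightarrow> complex \<Rightarrow> nat set" where
  "far_roots \<eta> n z v w = {i. i < n \<and> (\<forall>u\<in>closed_segment v w. \<eta> < dist (z i) u)}"

text \<open>Working with powers keeps \<open>c\<close> and \<open>M\<close> independent of
  \<open>q\<close>, \<open>n\<close> and \<open>p\<close>: \<open>c\<close> comes from the pointwise
  bound on edges with many far zeros, \<open>M\<close> from bounding the integral over all edges by
  that over those edges.\<close>

lemma polygon_boundary_integral_bound:
  assumes K: "convex_polygon K" and nonacute: "\<forall>v. v extreme_point_of K \<longrightarrow> interior_angle K v \<ge> pi / 2"
  obtains c M where "c > 0" "M \<ge> 1"
    "\<And>q n p. 1 \<le> q \<Longrightarrow> 1 \<le> n \<Longrightarrow> p \<in> polys_in K n \<Longrightarrow>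
       (c * real n) powr q * boundary_integral K (\<lambda>z. cmod (poly p z) powr q)
         \<le> M * boundary_integral K (\<lambda>z. cmod (poly (pderiv p) z) powr q)"
proof -
  note K' = convex_polygonD[OF K]
  note E = polygon_edgesD[OF _ K'(3)]
  let ?E = "polygon_edges K"
  obtain D where D: "D > 0" "\<And>x y. x \<in> K \<Longrightarrow> y \<in> K \<Longrightarrow> dist x y \<le> D"
    using compact_diameter_bound[OF K'(1)] by blast
  obtain \<mu> where l: "\<mu> > 0" "\<And>v w. (v, w) \<in> ?E \<Longrightarrow> \<mu> \<le> dist v w" using min_edge_length[OF K] by blast
  obtain \<eta>0 where eta0: "\<eta>0 > 0" "\<And>v w x. (v, w) \<in> ?E \<Longrightarrow> x \<in> closed_segment v w \<Longrightarrow> escapes K v w x \<eta>0"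
    using escapes_uniformly[OF K nonacute] by blast
  obtain d where d: "d > 0" "\<And>v w a b x y. (v, w) \<in> ?E \<Longrightarrow> (a, b) \<in> ?E \<Longrightarrow>
    closed_segment a b \<inter> closed_segment v w = {} \<Longrightarrow> x \<in> closed_segment v w \<Longrightarrow> y \<in> closed_segment a b \<Longrightarrow> d \<le> dist x y"
    using disjoint_edges_separated[OF K] by blast
  \<comment> \<open>A zero within \<open>\<eta>\<close> of one edge is then farther than
    \<open>\<eta>\<close> from every edge disjoint from it.\<close>
  define \<eta> where "\<eta> = min \<eta>0 (d / 3)"
  have eta: "\<eta> > 0" "2 * \<eta> < d" "\<eta> \<le> \<eta>0" using eta0 d(1) by (auto simp: \<eta>_def)
  have esc: "escapes K v w x \<eta>" if "(v, w) \<in> ?E" "x \<in> closed_segment v w" for v w x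
    using escapes_mono[OF eta0(2)[OF that] eta(1,3)] .
  obtain h where h: "h > 0" "\<And>v w. (v, w) \<in> ?E \<Longrightarrow> \<exists>\<nu>. edge_normal K v w \<nu> \<and>
    (\<forall>y\<in>K. (\<forall>u\<in>closed_segment v w. \<eta> < dist y u) \<longrightarrow> h \<le> \<nu> \<bullet> (y - v))"
    using height_lower_bound[OF K eta(1)] by blast
  \<comment> \<open>The loss in mean logarithm per far zero, uniform over the edges;
    \<open>g\<close> below is the gain per near zero.\<close>
  define C1 where "C1 = 8 / sqrt (\<mu> / D)"
  have C1: "C1 > 0" using l D by (simp add: C1_def)
  define g where "g = \<eta> * ln (1 + \<eta>)"
  have g: "g > 0" using eta by (simp add: g_def)
  \<comment> \<open>If fewer than \<open>\<epsilon> * n\<close> zeros are far from an edge, at least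
    half are near, and their total gain covers the loss from the far ones.\<close>
  define \<epsilon> where "\<epsilon> = min (1 / 2) (g / (2 * C1))"
  have eps: "\<epsilon> > 0" "\<epsilon> \<le> 1 / 2" "\<epsilon> * C1 \<le> g / 2"
  proof -
    show "\<epsilon> > 0" "\<epsilon> \<le> 1 / 2" using g C1 by (auto simp: \<epsilon>_def)
    have "\<epsilon> \<le> g / (2 * C1)" by (simp add: \<epsilon>_def)
    thus "\<epsilon> * C1 \<le> g / 2" using C1 by (simp add: field_simps)
  qed
  define c where "c = \<epsilon> * (h / D\<^sup>2)"
  have c: "c > 0" using eps h D by (simp add: c_def)
  \<comment> \<open>The entry 1 serves edges with many far zeros, the other entry the remaining
    edges.\<close>
  define B where "B = max 1 (D / (\<eta> * \<mu>))"
  have B: "B \<ge> 1" "D / (\<eta> * \<mu>) \<le> B" by (auto simp: B_def)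
  have "card ?E > 0" using K'(6) polygon_edges_nonempty[OF K] by (simp add: card_gt_0_iff)
  hence E1: "real (card ?E) \<ge> 1" by simp
  define M where "M = real (card ?E) * B"
  have M: "M \<ge> 1" using mult_mono[OF E1 B(1)] by (simp add: M_def)
  have "(c * real n) powr q * boundary_integral K (\<lambda>z. cmod (poly p z) powr q)
         \<le> M * boundary_integral K (\<lambda>z. cmod (poly (pderiv p) z) powr q)"
    if q: "1 \<le> q" and n: "1 \<le> n" and p: "p \<in> polys_in K n" for q :: real and n p
  proof -
    have p0: "p \<noteq> 0" using p n by (auto simp: polys_in_def)
    have q0: "q > 0" using q by simp
    obtain z where z: "p = smult (lead_coeff p) (\<Prod>i<n. [:- z i, 1:])" "\<And>i. i < n \<Longrightarrow> z i \<in> K"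
      using polys_in_indexed_roots[OF p p0] by blast
    let ?F = "far_roots \<eta> n z"
    define good where "good = (\<lambda>(v, w). \<epsilon> * real n \<le> real (card (?F v w)))"
    have Fn: "?F v w \<subseteq> {..<n}" "finite (?F v w)" for v w by (auto simp: far_roots_def)
    have deriv: "c * real n * cmod (poly p x) \<le> cmod (poly (pderiv p) x)"
      if e: "(v, w) \<in> ?E" "good (v, w)" "x \<in> closed_segment v w" for v w x
    proof -
      obtain \<nu> where nu: "edge_normal K v w \<nu>"
        "\<forall>y\<in>K. (\<forall>u\<in>closed_segment v w. \<eta> < dist y u) \<longrightarrow> h \<le> \<nu> \<bullet> (y - v)" using h(2)[OF e(1)] by blast
      note N = edge_normalD[OF nu(1)]
      obtain s where "x = (1 - s) *\<^sub>R v + s *\<^sub>R w" using e(3) by (auto simp: in_segment)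
      hence "\<nu> \<bullet> x = (1 - s) * (\<nu> \<bullet> v) + s * (\<nu> \<bullet> w)" by (simp only: inner_add_right inner_scaleR_right)
      hence "\<nu> \<bullet> x = \<nu> \<bullet> v" using N(3) by (simp add: algebra_simps)
      hence shift: "\<nu> \<bullet> (y - x) = \<nu> \<bullet> (y - v)" for y by (simp add: inner_diff_right)
      have xK: "x \<in> K" using E(4)[OF e(1)] e(3) by blast
      have "card (?F v w) * (h / D\<^sup>2) * cmod (poly p x) \<le> cmod (poly (pderiv p) x)"
      proof (rule derivative_lower_bound_half_plane[OF _ z(1) Fn(1) N(1)])
        fix i assume "i \<in> {..<n}"
        thus "\<nu> \<bullet> (z i - x) \<ge> 0" using N(4) z(2) by (simp add: shift)
      next
        fix i assume i: "i \<in> ?F v w"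
        hence zK: "z i \<in> K" using z(2) by (simp add: far_roots_def)
        show "\<nu> \<bullet> (z i - x) \<ge> h" using nu(2) zK i by (simp add: shift far_roots_def)
        show "dist x (z i) \<le> D" using D(2) xK zK by simp
      qed (use h in auto)
      moreover have "c * real n * cmod (poly p x) \<le> card (?F v w) * (h / D\<^sup>2) * cmod (poly p x)"
      proof (intro mult_right_mono)
        have "c * real n = (\<epsilon> * real n) * (h / D\<^sup>2)" by (simp add: c_def)
        also have "\<dots> \<le> card (?F v w) * (h / D\<^sup>2)" using e(2) h by (intro mult_right_mono) (auto simp: good_def)
        finally show "c * real n \<le> card (?F v w) * (h / D\<^sup>2)" .
      qed simp
      ultimately show ?thesis by simp
    qed
    \<comment> \<open>The share of the good edges in twice the boundary integral, each edge being
      listed in both orientations.\<close>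
    define G where "G = (\<Sum>(v, w)\<in>{e \<in> ?E. good e}. edge_mean q p v w * dist v w)"
    have term_le_G: "edge_mean q p v w * dist v w \<le> G" if "(v, w) \<in> ?E" "good (v, w)" for v w
    proof -
      have "(case (v, w) of (v, w) \<Rightarrow> edge_mean q p v w * dist v w) \<le> G" unfolding G_def
        using K'(6) that q0 by (intro member_le_sum) (auto simp: edge_mean_nonneg)
      thus ?thesis by simp
    qed
    have G0: "G \<ge> 0" unfolding G_def using q0 by (intro sum_nonneg) (auto simp: edge_mean_nonneg)
    have bad: "cmod (poly p x) powr q \<le> G / (\<eta> * \<mu>)"
      if e: "(v, w) \<in> ?E" "\<not> good (v, w)" "x \<in> closed_segment v w" for v w x
    proof -
      obtain a b t0 where ab: "(a, b) \<in> ?E" "closed_segment a b \<inter> closed_segment v w = {}"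
        and t0: "0 \<le> t0" "t0 + \<eta> \<le> 1"
        and far: "\<And>t y. t0 \<le> t \<Longrightarrow> t \<le> t0 + \<eta> \<Longrightarrow> y \<in> K \<Longrightarrow>
          \<exists>u\<in>closed_segment v w. dist y u \<le> \<eta> \<Longrightarrow> (1 + \<eta>) * dist x y \<le> dist (a + t *\<^sub>R (b - a)) y"
        using esc[OF e(1,3)] unfolding escapes_def by metis
      have xK: "x \<in> K" using E(4)[OF e(1)] e(3) by blast
      have few: "real (card (?F v w)) \<le> \<epsilon> * real n" using e(2) by (simp add: good_def)
      have cardc: "real (card ({..<n} - ?F v w)) = real n - real (card (?F v w))"
        using Fn card_mono[OF _ Fn(1)] by (simp add: card_Diff_subset of_nat_diff)
      have "\<epsilon> * real n \<le> (1 / 2) * real n" using eps by (intro mult_right_mono) auto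
      hence many: "real (card ({..<n} - ?F v w)) \<ge> real n / 2" "\<epsilon> * real n \<le> real n / 2" using few cardc by auto
      \<comment> \<open>Zeros near the bad edge are far from the disjoint edge across
        \<open>K\<close>, which is therefore good.\<close>
      have "{..<n} - ?F v w \<subseteq> ?F a b"
      proof
        fix i assume i: "i \<in> {..<n} - ?F v w"
        then obtain u where u: "u \<in> closed_segment v w" "dist (z i) u \<le> \<eta>" by (auto simp: far_roots_def not_less)
        have "\<eta> < dist (z i) y" if "y \<in> closed_segment a b" for y
          using d(2)[OF e(1) ab u(1) that] u(2) eta(2) dist_triangle[of u y "z i"] by (simp add: dist_commute)
        thus "i \<in> ?F a b" using i by (simp add: far_roots_def)
      qed
      hence "card ({..<n} - ?F v w) \<le> card (?F a b)" by (intro card_mono Fn)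
      hence gab: "good (a, b)" using many by (simp add: good_def)
      have "\<eta> * cmod (poly p x) powr q \<le> edge_mean q p a b" unfolding edge_mean_def
      proof (rule poly_powr_le_segment_integral[OF _ Fn(1) z(1) t0(1) eta(1) t0(2) q0 E(3)[OF ab(1)] D(1)])
        fix i t assume i: "i \<in> {..<n} - ?F v w" and t: "t0 \<le> t" "t \<le> t0 + \<eta>"
        show "(1 + \<eta>) * dist x (z i) \<le> dist (a + t *\<^sub>R (b - a)) (z i)"
          using i z(2) by (intro far t) (auto simp: far_roots_def not_less)
      next
        fix i assume "i \<in> ?F v w"
        thus "dist x (z i) \<le> D" using D(2) xK z(2) by (simp add: far_roots_def)
      next
        have "8 / sqrt (dist a b / D) \<le> C1" unfolding C1_def
          using l D by (intro divide_left_mono real_sqrt_le_mono divide_right_mono mult_pos_pos)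
            (auto intro!: divide_pos_pos less_le_trans[OF l(1) l(2)[OF ab(1)]] simp: ab)
        hence "card (?F v w) * (8 / sqrt (dist a b / D)) \<le> (\<epsilon> * real n) * C1"
          using few l D by (intro mult_mono) auto
        also have "\<dots> = (\<epsilon> * C1) * real n" by simp
        also have "\<dots> \<le> g / 2 * real n" using eps by (intro mult_right_mono) auto
        also have "\<dots> = g * (real n / 2)" by simp
        also have "\<dots> \<le> g * card ({..<n} - ?F v w)" using many g by (intro mult_left_mono) auto
        finally show "card (?F v w) * (8 / sqrt (dist a b / D)) \<le> \<eta> * ln (1 + \<eta>) * card ({..<n} - ?F v w)"
          by (simp add: g_def)
      qed simp
      hence "\<mu> * (\<eta> * cmod (poly p x) powr q) \<le> dist a b * edge_mean q p a b"
        using l eta ab(1) by (intro mult_mono) auto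
      also have "\<dots> \<le> G" using term_le_G[OF ab(1) gab] by (simp add: mult.commute)
      finally show ?thesis using l eta by (simp add: field_simps)
    qed
    have all: "edge_mean q p v w * dist v w \<le> B * G" if e: "(v, w) \<in> ?E" for v w
    proof (cases "good (v, w)")
      case True
      have "1 * G \<le> B * G" using B G0 by (intro mult_right_mono) auto
      thus ?thesis using term_le_G[OF e True] by simp
    next
      case False
      have "edge_mean q p v w * dist v w \<le> G / (\<eta> * \<mu>) * D"
        using bad[OF e False] q0 G0 eta l D E(1,2)[OF e] by (intro mult_mono edge_mean_le) auto
      also have "\<dots> = D / (\<eta> * \<mu>) * G" by simp
      also have "\<dots> \<le> B * G" using B G0 by (intro mult_right_mono) auto
      finally show ?thesis .
    qed
    have "(c * real n) powr q * G = (\<Sum>(v, w)\<in>{e \<in> ?E. good e}. (c * real n) powr q * (edge_mean q p v w * dist v w))"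
      by (simp add: G_def sum_distrib_left case_prod_unfold)
    also have "\<dots> \<le> (\<Sum>(v, w)\<in>{e \<in> ?E. good e}. edge_mean q (pderiv p) v w * dist v w)"
    proof (intro sum_mono, clarify)
      fix v w assume e: "(v, w) \<in> ?E" "good (v, w)"
      have "(c * real n) powr q * edge_mean q p v w \<le> edge_mean q (pderiv p) v w"
        using q0 c deriv[OF e] by (intro edge_mean_mono) auto
      thus "(c * real n) powr q * (edge_mean q p v w * dist v w) \<le> edge_mean q (pderiv p) v w * dist v w"
        by (simp add: mult_right_mono flip: mult.assoc)
    qed
    also have "\<dots> \<le> (\<Sum>(v, w)\<in>?E. edge_mean q (pderiv p) v w * dist v w)"
      using K'(6) q0 by (intro sum_mono2) (auto simp: edge_mean_nonneg)
    finally have low: "(c * real n) powr q * G \<le> 2 * boundary_integral K (\<lambda>z. cmod (poly (pderiv p) z) powr q)"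
      by (simp add: boundary_integral_poly)
    have "2 * boundary_integral K (\<lambda>z. cmod (poly p z) powr q) = (\<Sum>(v, w)\<in>?E. edge_mean q p v w * dist v w)"
      by (simp add: boundary_integral_poly)
    also have "\<dots> \<le> (\<Sum>(v, w)\<in>?E. B * G)" using all by (intro sum_mono) auto
    also have "\<dots> = M * G" by (simp add: M_def)
    finally have "(c * real n) powr q * (2 * boundary_integral K (\<lambda>z. cmod (poly p z) powr q)) \<le> (c * real n) powr q * (M * G)"
      by (intro mult_left_mono) auto
    also have "\<dots> = M * ((c * real n) powr q * G)" by simp
    also have "\<dots> \<le> M * (2 * boundary_integral K (\<lambda>z. cmod (poly (pderiv p) z) powr q))"
      using low M by (intro mult_left_mono) auto
    finally show ?thesis by simp
  qed
  thus ?thesis using that[OF c M] by blast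
qed

lemma boundary_integral_poly_pos:
  assumes "convex_polygon K" "p \<noteq> 0" "q > 0"
  shows "boundary_integral K (\<lambda>z. cmod (poly p z) powr q) > 0"
proof -
  note K = convex_polygonD[OF assms(1)]
  have "(\<Sum>(v, w)\<in>polygon_edges K. edge_mean q p v w * dist v w) > 0"
    using K polygon_edges_nonempty[OF assms(1)] assms(2,3)
    by (intro sum_pos) (auto simp: edge_mean_pos polygon_edges_def)
  thus ?thesis by (simp add: boundary_integral_poly)
qed

theorem theorem2:
  fixes K :: "complex set"
  assumes "convex_polygon K"
    and "\<forall>v. v extreme_point_of K \<longrightarrow> interior_angle K v \<ge> pi / 2"
  shows "\<exists>C>0. \<forall>q::real. \<forall>n::nat. 1 \<le> q \<longrightarrow> 1 \<le> n \<longrightarrow>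
           oscillation_factor n q K > C * real n"
proof -
  obtain c M where c: "c > 0" and M: "M \<ge> 1" and
    bound: "\<And>q n p. 1 \<le> q \<Longrightarrow> 1 \<le> n \<Longrightarrow> p \<in> polys_in K n \<Longrightarrow>
       (c * real n) powr q * boundary_integral K (\<lambda>z. cmod (poly p z) powr q)
         \<le> M * boundary_integral K (\<lambda>z. cmod (poly (pderiv p) z) powr q)"
    using polygon_boundary_integral_bound[OF assms] by blast
  \<comment> \<open>An infimum inherits only a weak inequality; halving the constant makes it
    strict.\<close>
  have "c / (2 * M) * real n < oscillation_factor n q K" if q: "1 \<le> q" and n: "1 \<le> n" for q n
  proof -
    have "c / (2 * M) * real n < c / M * real n" using c M n by (simp add: field_simps)
    also have "c / M * real n \<le> oscillation_factor n q K" unfolding oscillation_factor_def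
    proof (rule cINF_greatest)
      obtain a where "a \<in> K" using convex_polygonD(4)[OF assms(1)] interior_subset by blast
      hence "[:- a, 1:] ^ n \<in> polys_in K n" by (auto simp: polys_in_def degree_power_eq poly_power)
      thus "polys_in K n \<noteq> {}" by blast
    next
      fix p assume p: "p \<in> polys_in K n"
      define I where "I = (\<lambda>p. boundary_integral K (\<lambda>z. cmod (poly p z) powr q))"
      have p0: "p \<noteq> 0" using p n by (auto simp: polys_in_def)
      have Ip: "I p > 0" unfolding I_def using boundary_integral_poly_pos[OF assms(1) p0] q by simp
      have "(c * real n) * I p powr (1 / q) = ((c * real n) powr q * I p) powr (1 / q)"
        using c Ip q by (simp add: powr_mult powr_powr)
      also have "\<dots> \<le> (M * I (pderiv p)) powr (1 / q)"
        using bound[OF q n p] Ip q by (intro powr_mono2) (auto simp: I_def)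
      also have "\<dots> = M powr (1 / q) * I (pderiv p) powr (1 / q)"
      proof -
        have "0 \<le> (c * real n) powr q * I p" using Ip by simp
        also have "\<dots> \<le> M * I (pderiv p)" using bound[OF q n p] by (simp add: I_def)
        finally have "I (pderiv p) \<ge> 0" using M by (simp add: zero_le_mult_iff)
        thus ?thesis using M by (simp add: powr_mult)
      qed
      \<comment> \<open>Since \<open>M \<ge> 1\<close> and \<open>1 / q \<le> 1\<close>, the root of
        \<open>M\<close> is at most \<open>M\<close>, which removes \<open>q\<close> from the
        constant.\<close>
      also have "\<dots> \<le> M * I (pderiv p) powr (1 / q)"
        using M q powr_mono[of "1 / q" 1 M] by (intro mult_right_mono) auto
      finally have "c / M * real n \<le> I (pderiv p) powr (1 / q) / I p powr (1 / q)"
        using M Ip by (simp add: field_simps)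
      thus "c / M * real n \<le> Lq_boundary_norm K q (poly (pderiv p)) / Lq_boundary_norm K q (poly p)"
        by (simp add: Lq_boundary_norm_def I_def)
    qed
    finally show ?thesis .
  qed
  thus ?thesis using c M by (intro exI[of _ "c / (2 * M)"]) auto
qed

end
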